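(* Let $\mathcal{L}$ be a finite distributive lattice, let $\sigma$ be the cone associated to the Hibi toric variety $X_{\mathcal{L}}$, let $\tau$ be a face of $\sigma$, and let $\Gamma$ be a maximal chain in $D_\tau$. Then $$\{\overline{F}_{[\theta]} : [\theta]\in G_\tau(\Gamma)\}\ \dot\cup\ \{\overline{F}_\gamma : \gamma\in\Gamma\}$$ (a disjoint union) is a $K$-basis of the cotangent space $M_{P_\tau}/M_{P_\tau}^2$ of $X_{\mathcal{L}}$ at $P_\tau$.
   Context: $K$ is an algebraically closed field of arbitrary characteristic. $\mathcal{L}$ is a finite distributive lattice with join $\vee$ and meet $\wedge$. $J_{\mathcal{L}}$ is the set of join-irreducible elements, i.e. those $z\in\mathcal{L}$ such that $z=x\vee y$ implies $z=x$ or $z=y$ (so the minimal element $\hat 0$ belongs to $J_{\mathcal{L}}$). For $\alpha\in\mathcal{L}$, $I_\alpha=\{\theta\in J_{\mathcal{L}} : \theta\le\alpha\}$. The Hibi toric variety $X_{\mathcal{L}}\subset\mathbb{A}^{\#\mathcal{L}}$ is the affine variety whose vanishing ideal in $K[X_\alpha,\alpha\in\mathcal{L}]$ is the (prime) ideal generated by all $X_\alpha X_\beta-X_{\alpha\vee\beta}X_{\alpha\wedge\beta}$, $\alpha,\beta\in\mathcal{L}$. Let $R_{\mathcal{L}}=K[X_{\mathcal{L}}]$ be its coordinate ring and $x_\alpha$ the image of $X_\alpha$ in $R_{\mathcal{L}}$. Let $T=(K^* )^{J_{\mathcal{L}}}$, $M=X(T)$ its character group with $\mathbb{Z}$-basis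 the coordinate characters $f_\beta$, $\beta\in J_{\mathcal{L}}$, and $N$ the $\mathbb{Z}$-dual of $M$. Put $f_{I_\alpha}=\sum_{z\in I_\alpha}f_z$. The map $t\mapsto (f_{I_\alpha}(t))_{\alpha\in\mathcal{L}}$ embeds $T$ as a dense open subset of $X_{\mathcal{L}}$ and makes $X_{\mathcal{L}}$ a normal affine toric variety; $\sigma\subset N\otimes\mathbb{R}$ is the strongly convex rational polyhedral cone such that $K[X_{\mathcal{L}}]$ (viewed inside $K[T]=K[M]$) equals the semigroup algebra $K[S_\sigma]$, $S_\sigma=\sigma^\vee\cap M$. A face of $\sigma$ is a cone $\tau=\sigma\cap u^\perp$ with $u\in\sigma^\vee$; $\tau^\perp$ is the set of elements of $M\otimes\mathbb{R}$ vanishing on $\tau$. $P_\tau\in X_{\mathcal{L}}$ is the point whose $\alpha$-coordinate $P_\tau(\alpha)$ is $1$ if $f_{I_\alpha}\in\tau^\perp$ and $0$ otherwise; $M_{P_\tau}\subset R_{\mathcal{L}}$ is its maximal ideal. $D_\tau=\{\alpha\in\mathcal{L} : P_\tau(\alpha)\ne 0\}$. Set $F_\alpha=x_\alpha$ if $\alpha\notin D_\tau$ and $F_\alpha=1-x_\alpha$ if $\alpha\in D_\tau$; $\overline{F}$ denotes the class of $F\in M_{P_\tau}$ in $M_{P_\tau}/M_{P_\tau}^2$. A diamond is a quadruple $(\alpha,\beta,\alpha\vee\beta,\alpha\wedge\beta)$ with $\alpha,\beta$ non-comparable; its diagonals are the pairs $\{\alpha,\beta\}$ and $\{\alpha\vee\beta,\alpha\wedge\beta\}$,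 and its sides are the other pairs of vertices, with opposite sides $\{\alpha,\alpha\vee\beta\},\{\alpha\wedge\beta,\beta\}$ and $\{\beta,\alpha\vee\beta\},\{\alpha\wedge\beta,\alpha\}$. $E_\tau$ is the set of $\alpha\in\mathcal{L}\setminus D_\tau$ for which there are $\beta\in D_\tau$ and a diamond $D$ in $\mathcal{L}$ such that $(\alpha,\beta)$ is a diagonal of $D$ and $D\cap D_\tau=\{\beta\}$. Equivalence relation on $\mathcal{L}\setminus D_\tau$: $\theta\sim\delta$ if $\theta=\delta$ or there is a sequence $\theta=\theta_1,\dots,\theta_n=\delta$ in $\mathcal{L}\setminus D_\tau$ such that each $(\theta_i,\theta_{i+1})$ is a side of a diamond in $\mathcal{L}$ whose opposite side is contained in $D_\tau$. $[\theta]$ is the class of $\theta$. The class $\overline{F}_\theta$ depends only on $[\theta]$ and is denoted $\overline{F}_{[\theta]}$. $\Lambda_\tau(\Gamma)$ is the union of all maximal chains of $\mathcal{L}$ containing $\Gamma$ (equivalently, the set of elements of $\mathcal{L}$ comparable to every $\gamma\in\Gamma$). $Z_\tau(\Gamma)=\Lambda_\tau(\Gamma)\setminus(\Gamma\cup E_\tau)$, and $G_\tau(\Gamma)=\{[\theta] : \theta\in Z_\tau(\Gamma),\ [\theta]\cap E_\tau=\emptyset\}$. *)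

theory Defs
  imports
    "HOL-Analysis.Analysis"
    "HOL-Library.Poly_Mapping"
    "HOL-Algebra.Ideal_Product"
    "HOL-Algebra.QuotRing"
    "HOL-Algebra.Algebraic_Closure_Type"
    "Jordan_Normal_Form.Missing_VectorSpace"
begin

section \<open>Polynomial rings and cotangent spaces\<close>

type_synonym ('l, 'k) mpol = "('l \<Rightarrow>\<^sub>0 nat) \<Rightarrow>\<^sub>0 'k"

text \<open>
  \<^typ>\<open>('l, 'k) mpol\<close> is the polynomial ring \<open>K[X\<^sub>\<alpha>, \<alpha> \<in> L]\<close>, where the index set \<open>L\<close> is the
  whole type \<^typ>\<open>'l\<close>: monomials are finitely supported exponent vectors, and multiplication is
  convolution.
\<close>

definition mpol_const :: "'k::zero \<Rightarrow> ('l, 'k) mpol" where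
  "mpol_const c = Poly_Mapping.single 0 c"

definition mpol_var :: "'l \<Rightarrow> ('l, 'k::zero_neq_one) mpol" where
  "mpol_var \<alpha> = Poly_Mapping.single (Poly_Mapping.single \<alpha> 1) 1"

text \<open>
  Substitution of \<open>g \<alpha>\<close> for \<open>X\<^sub>\<alpha>\<close> in a commutative ring whose structure map from the coefficients
  is \<open>\<phi>\<close>.
\<close>

definition mpol_eval ::
    "('k::zero \<Rightarrow> 'r::comm_ring_1) \<Rightarrow> ('l::finite \<Rightarrow> 'r) \<Rightarrow> ('l, 'k) mpol \<Rightarrow> 'r" where
  "mpol_eval \<phi> g p =
     (\<Sum>m\<in>Poly_Mapping.keys p. \<phi> (Poly_Mapping.lookup p m) *
        (\<Prod>\<alpha>\<in>UNIV. g \<alpha> ^ Poly_Mapping.lookup m \<alpha>))"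

text \<open>
  For an ideal \<open>M\<close> of a ring \<open>R\<close> that is a \<open>K\<close>-algebra via \<open>\<phi>\<close>, the \<open>K\<close>-module \<open>M/M\<^sup>2\<close>, as a
  submodule of \<open>R/M\<^sup>2\<close>.  The fields \<open>mult\<close> and \<open>one\<close> of the record play no role in the theory of
  modules.
\<close>

definition cotangent_space ::
    "('k \<Rightarrow> 'r) \<Rightarrow> 'r ring \<Rightarrow> 'r set \<Rightarrow> ('k, 'r set) module" where
  "cotangent_space \<phi> R M =
     (let M2 = ideal_prod R M M; Q = FactRing R M2 in
      \<lparr>carrier = (\<lambda>m. M2 +>\<^bsub>R\<^esub> m) ` M,
       monoid.mult = (\<otimes>\<^bsub>Q\<^esub>), one = \<one>\<^bsub>Q\<^esub>, zero = \<zero>\<^bsub>Q\<^esub>, add = (\<oplus>\<^bsub>Q\<^esub>),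
       smult = (\<lambda>c v. (M2 +>\<^bsub>R\<^esub> \<phi> c) \<otimes>\<^bsub>Q\<^esub> v)\<rparr>)"

section \<open>The coordinate ring of a Hibi variety\<close>

definition hibi_ideal :: "('l::{finite,distrib_lattice}, 'k::field) mpol set" where
  "hibi_ideal =
     Idl\<^bsub>ring_of_type_algebra\<^esub>
       {mpol_var \<alpha> * mpol_var \<beta> - mpol_var (sup \<alpha> \<beta>) * mpol_var (inf \<alpha> \<beta>) | \<alpha> \<beta>. True}"

definition hibi_ring :: "('l::{finite,distrib_lattice}, 'k::field) mpol set ring" where
  "hibi_ring = FactRing ring_of_type_algebra hibi_ideal"

definition hibi_class ::
    "('l::{finite,distrib_lattice}, 'k::field) mpol \<Rightarrow> ('l, 'k) mpol set" where
  "hibi_class p = hibi_ideal +>\<^bsub>ring_of_type_algebra\<^esub> p"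

text \<open>
  The maximal ideal of a point \<open>P\<close>, given by its coordinates.  It is the image in the coordinate
  ring of the maximal ideal of \<open>P\<close> in the polynomial ring, and hence is meaningful for points of
  the variety only.
\<close>

definition maximal_ideal_at ::
    "('l::{finite,distrib_lattice} \<Rightarrow> 'k::field) \<Rightarrow> ('l, 'k) mpol set set" where
  "maximal_ideal_at P = hibi_class ` {p. mpol_eval (\<lambda>c. c) P p = 0}"

definition hibi_cotangent ::
    "('l::{finite,distrib_lattice} \<Rightarrow> 'k::field) \<Rightarrow> ('k, ('l, 'k) mpol set set) module" where
  "hibi_cotangent P =
     cotangent_space (\<lambda>c. hibi_class (mpol_const c)) hibi_ring (maximal_ideal_at P)"

section \<open>The torus and the cone\<close>

definition join_irreducibles :: "'l::lattice set" where
  "join_irreducibles = {z. \<forall>x y. z = sup x y \<longrightarrow> z = x \<or> z = y}"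

definition irr_below :: "'l::lattice \<Rightarrow> 'l set" where
  "irr_below \<alpha> = {\<theta> \<in> join_irreducibles. \<theta> \<le> \<alpha>}"

text \<open>
  Both \<open>M \<otimes> \<real>\<close> and \<open>N \<otimes> \<real>\<close> are \<open>\<real>\<^sup>J\<close> for \<open>J\<close> the set of join-irreducibles, with \<open>M\<close> and \<open>N\<close>
  the integral vectors in it: the basis element \<open>f\<^sub>z\<close> of \<open>M\<close> and the corresponding element of the
  dual basis of \<open>N\<close> are both \<open>axis z 1\<close>, so the pairing is the inner product.  \<open>\<real>\<^sup>J\<close> is realised
  as the vectors in \<open>\<real>\<^sup>L\<close> with support in \<open>J\<close>.
\<close>

definition irr_space :: "(real, 'l::{finite,distrib_lattice}) vec set" where
  "irr_space = {u. \<forall>z. z \<notin> join_irreducibles \<longrightarrow> u $ z = 0}"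

definition irr_lattice :: "(real, 'l::{finite,distrib_lattice}) vec set" where
  "irr_lattice = {u \<in> irr_space. \<forall>z. u $ z \<in> \<int>}"

definition f_char :: "'l::{finite,distrib_lattice} \<Rightarrow> (real, 'l) vec" where
  "f_char \<alpha> = (\<Sum>z\<in>irr_below \<alpha>. axis z 1)"

definition dual_cone ::
    "(real, 'l::{finite,distrib_lattice}) vec set \<Rightarrow> (real, 'l) vec set" where
  "dual_cone \<sigma> = {u \<in> irr_space. \<forall>v\<in>\<sigma>. 0 \<le> u \<bullet> v}"

definition perp ::
    "(real, 'l::{finite,distrib_lattice}) vec set \<Rightarrow> (real, 'l) vec set" where
  "perp \<tau> = {u \<in> irr_space. \<forall>v\<in>\<tau>. u \<bullet> v = 0}"

definition rational_polyhedral_cone ::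
    "(real, 'l::{finite,distrib_lattice}) vec set \<Rightarrow> bool" where
  "rational_polyhedral_cone \<sigma> \<longleftrightarrow>
     (\<exists>S. finite S \<and> S \<subseteq> irr_lattice \<and> \<sigma> = convex_cone hull S)"

definition strongly_convex_cone :: "(real, 'l::finite) vec set \<Rightarrow> bool" where
  "strongly_convex_cone \<sigma> \<longleftrightarrow> \<sigma> \<inter> uminus ` \<sigma> = {0}"

definition cone_face ::
    "(real, 'l::{finite,distrib_lattice}) vec set \<Rightarrow> (real, 'l) vec set \<Rightarrow> bool" where
  "cone_face \<tau> \<sigma> \<longleftrightarrow> (\<exists>u\<in>dual_cone \<sigma>. \<tau> = {v \<in> \<sigma>. u \<bullet> v = 0})"

text \<open>
  \<open>K[M]\<close> consists of the elements of \<^typ>\<open>(real, 'l) vec \<Rightarrow>\<^sub>0 'k\<close> with all exponents in \<open>M\<close>, the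
  character \<open>\<chi>\<^sup>u\<close> being \<open>single u 1\<close>.  The coordinate ring of \<open>X\<^sub>L\<close>, viewed inside \<open>K[M]\<close>, is the
  image of the polynomial ring under the pullback \<open>X\<^sub>\<alpha> \<mapsto> \<chi>\<^sup>f\<close>, \<open>f = f_char \<alpha>\<close>, along the embedding
  of the torus.
\<close>

definition torus_pullback ::
    "('l::{finite,distrib_lattice}, 'k::field) mpol \<Rightarrow> (real, 'l) vec \<Rightarrow>\<^sub>0 'k" where
  "torus_pullback =
     mpol_eval (Poly_Mapping.single 0) (\<lambda>\<alpha>. Poly_Mapping.single (f_char \<alpha>) 1)"

definition semigroup_algebra :: "'a set \<Rightarrow> ('a \<Rightarrow>\<^sub>0 'k::zero) set" where
  "semigroup_algebra S = {p. Poly_Mapping.keys p \<subseteq> S}"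

definition is_hibi_cone ::
    "'k::field itself \<Rightarrow> (real, 'l::{finite,distrib_lattice}) vec set \<Rightarrow> bool" where
  "is_hibi_cone (_ :: 'k itself) \<sigma> \<longleftrightarrow>
     rational_polyhedral_cone \<sigma> \<and> strongly_convex_cone \<sigma> \<and>
     torus_pullback ` (UNIV :: ('l, 'k) mpol set) =
       semigroup_algebra (dual_cone \<sigma> \<inter> irr_lattice)"

definition face_point ::
    "(real, 'l::{finite,distrib_lattice}) vec set \<Rightarrow> 'l \<Rightarrow> 'k::field" where
  "face_point \<tau> \<alpha> = (if f_char \<alpha> \<in> perp \<tau> then 1 else 0)"

definition point_support :: "('l \<Rightarrow> 'k::zero) \<Rightarrow> 'l set" where
  "point_support P = {\<alpha>. P \<alpha> \<noteq> 0}"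

definition F_elem ::
    "('l::{finite,distrib_lattice} \<Rightarrow> 'k::field) \<Rightarrow> 'l \<Rightarrow> ('l, 'k) mpol set" where
  "F_elem P \<alpha> =
     (if \<alpha> \<in> point_support P
      then \<one>\<^bsub>hibi_ring\<^esub> \<ominus>\<^bsub>hibi_ring\<^esub> hibi_class (mpol_var \<alpha>)
      else hibi_class (mpol_var \<alpha>))"

definition F_bar ::
    "('l::{finite,distrib_lattice} \<Rightarrow> 'k::field) \<Rightarrow> 'l \<Rightarrow> ('l, 'k) mpol set set" where
  "F_bar P \<alpha> =
     ideal_prod hibi_ring (maximal_ideal_at P) (maximal_ideal_at P) +>\<^bsub>hibi_ring\<^esub> F_elem P \<alpha>"

text \<open>The common value of \<^term>\<open>F_bar P\<close> on an equivalence class \<open>C\<close>.\<close>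

definition F_bar_class ::
    "('l::{finite,distrib_lattice} \<Rightarrow> 'k::field) \<Rightarrow> 'l set \<Rightarrow> ('l, 'k) mpol set set" where
  "F_bar_class P C = the_elem (F_bar P ` C)"

section \<open>Combinatorics of the lattice\<close>

text \<open>
  A diamond is represented by two non-comparable elements \<open>a\<close>, \<open>b\<close>; its vertices are \<open>a\<close>, \<open>b\<close>,
  \<open>sup a b\<close> and \<open>inf a b\<close>.
\<close>

definition diamond :: "'l::lattice \<Rightarrow> 'l \<Rightarrow> bool" where
  "diamond a b \<longleftrightarrow> \<not> a \<le> b \<and> \<not> b \<le> a"

definition diamond_vertices :: "'l::lattice \<Rightarrow> 'l \<Rightarrow> 'l set" where
  "diamond_vertices a b = {a, b, sup a b, inf a b}"

definition diamond_diagonals :: "'l::lattice \<Rightarrow> 'l \<Rightarrow> 'l set set" where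
  "diamond_diagonals a b = {{a, b}, {sup a b, inf a b}}"

definition opposite_sides :: "'l::lattice \<Rightarrow> 'l \<Rightarrow> ('l set \<times> 'l set) set" where
  "opposite_sides a b =
     {({a, sup a b}, {inf a b, b}), ({inf a b, b}, {a, sup a b}),
      ({b, sup a b}, {inf a b, a}), ({inf a b, a}, {b, sup a b})}"

definition E_set :: "'l::lattice set \<Rightarrow> 'l set" where
  "E_set D = {\<alpha>. \<alpha> \<notin> D \<and> (\<exists>\<beta>\<in>D. \<exists>a b. diamond a b \<and>
     {\<alpha>, \<beta>} \<in> diamond_diagonals a b \<and> diamond_vertices a b \<inter> D = {\<beta>})}"

definition side_step :: "'l::lattice set \<Rightarrow> ('l \<times> 'l) set" where
  "side_step D = {(\<theta>, \<delta>). \<theta> \<notin> D \<and> \<delta> \<notin> D \<and> (\<exists>a b S. diamond a b \<and>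
     ({\<theta>, \<delta>}, S) \<in> opposite_sides a b \<and> S \<subseteq> D)}"

definition side_equiv :: "'l::lattice set \<Rightarrow> ('l \<times> 'l) set" where
  "side_equiv D = {(\<theta>, \<delta>). \<theta> \<notin> D \<and> \<delta> \<notin> D \<and> (\<theta>, \<delta>) \<in> (side_step D)\<^sup>*}"

definition Lambda_set :: "'l::lattice set \<Rightarrow> 'l set" where
  "Lambda_set \<Gamma> = \<Union>{C. pred_on.maxchain UNIV (<) C \<and> \<Gamma> \<subseteq> C}"

definition Z_set :: "'l::lattice set \<Rightarrow> 'l set \<Rightarrow> 'l set" where
  "Z_set D \<Gamma> = Lambda_set \<Gamma> - (\<Gamma> \<union> E_set D)"

definition G_set :: "'l::lattice set \<Rightarrow> 'l set \<Rightarrow> 'l set set" where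
  "G_set D \<Gamma> = {side_equiv D `` {\<theta>} | \<theta>. \<theta> \<in> Z_set D \<Gamma> \<and> side_equiv D `` {\<theta>} \<inter> E_set D = {}}"

end

theory Submission
  imports Defs
begin

text \<open>
  Write \<open>s\<close> and \<open>i\<close> for join and meet of \<open>a\<close> and \<open>b\<close>.  The point \<open>P\<close> of the face is the indicator
  function of \<open>D\<close>.  Since the characters \<open>f\<^sub>\<alpha>\<close> are nonnegative on the cone and satisfy
  \<open>f\<^sub>a + f\<^sub>b = f\<^sub>s + f\<^sub>i\<close>, the elements \<open>a\<close>, \<open>b\<close> are both in \<open>D\<close> if and only if \<open>s\<close>, \<open>i\<close> are
  (\<open>face_support_two_sided_closed\<close>).  Expanding the Hibi binomials at \<open>P\<close> to first order, the cotangent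
  space is the space spanned by symbols \<open>y\<^sub>\<alpha>\<close>, \<open>\<alpha> \<in> L\<close>, subject to the linear relations
  \<open>P\<^sub>a y\<^sub>b + P\<^sub>b y\<^sub>a = P\<^sub>s y\<^sub>i + P\<^sub>i y\<^sub>s\<close>; its linear forms are the vectors \<open>l\<close> with
  \<open>P\<^sub>a l\<^sub>b + P\<^sub>b l\<^sub>a = P\<^sub>s l\<^sub>i + P\<^sub>i l\<^sub>s\<close>.  The rest is linear algebra and combinatorics.

  According to which vertices of a diamond lie in \<open>D\<close>, its relation says one of the following: nothing
  (no vertex); \<open>y\<^sub>\<theta> = 0\<close> for the vertex \<open>\<theta>\<close> opposite to a single vertex in \<open>D\<close>, that is, for
  \<open>\<theta> \<in> E_set D\<close>; \<open>y\<^sub>\<theta> = y\<^sub>\<delta>\<close> for the side opposite to a side in \<open>D\<close>, that is, for generators of the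
  equivalence relation; or \<open>y\<^sub>a + y\<^sub>b = y\<^sub>s + y\<^sub>i\<close> inside the sublattice \<open>D\<close>.  So the space splits into two
  parts.  The part outside \<open>D\<close> has as a basis the equivalence classes that avoid \<open>E_set D\<close>, with the
  indicator functions of the classes as dual basis (\<open>tangent_vector_class\<close>).  Each such class has a
  representative comparable with all of \<open>\<Gamma>\<close> (\<open>class_meets_comparable\<close>), so these classes are the
  members of \<open>G_set D \<Gamma>\<close>.  The part inside \<open>D\<close> is dual to the valuations on \<open>D\<close>.  It is spanned by a
  maximal chain, because the modular relation lets one climb from \<open>inf \<alpha> \<delta>\<close> to \<open>inf \<alpha> \<gamma>\<close> for
  consecutive \<open>\<delta> < \<gamma>\<close> in the chain (\<open>maxchain_generates\<close>), and the chain is independent, because in a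
  distributive lattice filters of join-prime elements provide valuations dual to it
  (\<open>valuation_dual_to_chain\<close>).
\<close>

section \<open>Evaluation of polynomials\<close>

lemma mpol_eval_eq_sum:
  assumes "\<phi> 0 = 0" and "finite S" and "Poly_Mapping.keys p \<subseteq> S"
  shows "mpol_eval \<phi> g p =
    (\<Sum>m\<in>S. \<phi> (Poly_Mapping.lookup p m) * (\<Prod>\<alpha>\<in>UNIV. g \<alpha> ^ Poly_Mapping.lookup m \<alpha>))"
  unfolding mpol_eval_def using assms
  by (intro sum.mono_neutral_left) (auto simp: in_keys_iff)

lemma mpol_eval_single:
  assumes "\<phi> 0 = 0"
  shows "mpol_eval \<phi> g (Poly_Mapping.single m c) =
    \<phi> c * (\<Prod>\<alpha>\<in>UNIV. g \<alpha> ^ Poly_Mapping.lookup m \<alpha>)"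
  using assms mpol_eval_eq_sum[where \<phi> = \<phi> and S = "{m}" and p = "Poly_Mapping.single m c"] by simp

lemma mpol_eval_const:
  assumes "\<phi> 0 = 0"
  shows "mpol_eval \<phi> g (mpol_const c) = \<phi> c"
  by (simp add: mpol_const_def mpol_eval_single assms)

lemma mpol_eval_var:
  assumes "\<phi> 0 = 0" and "\<phi> 1 = 1"
  shows "mpol_eval \<phi> g (mpol_var \<alpha>) = g \<alpha>"
proof -
  have "(\<Prod>\<beta>\<in>UNIV. g \<beta> ^ Poly_Mapping.lookup (Poly_Mapping.single \<alpha> 1) \<beta>)
      = (\<Prod>\<beta>\<in>UNIV. if \<beta> = \<alpha> then g \<beta> else 1)"
    by (intro prod.cong) (auto simp: lookup_single)
  then show ?thesis by (simp add: mpol_var_def mpol_eval_single assms)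
qed

lemma mpol_eval_add:
  assumes "\<phi> 0 = 0" and "\<And>x y. \<phi> (x + y) = \<phi> x + \<phi> y"
  shows "mpol_eval \<phi> g (p + q) = mpol_eval \<phi> g p + mpol_eval \<phi> g q"
proof -
  let ?S = "Poly_Mapping.keys p \<union> Poly_Mapping.keys q"
  have "Poly_Mapping.keys (p + q) \<subseteq> ?S" by (rule keys_add)
  then show ?thesis
    by (simp add: mpol_eval_eq_sum[where \<phi> = \<phi> and S = ?S] assms lookup_add sum.distrib algebra_simps)
qed

lemma poly_mapping_add_induct [case_names zero add]:
  fixes p :: "'a \<Rightarrow>\<^sub>0 'b::monoid_add"
  assumes zero: "Q 0" and add: "\<And>p m c. Q p \<Longrightarrow> Q (p + Poly_Mapping.single m c)"
  shows "Q p"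
proof (induction p rule: update_induct)
  case const
  show ?case by (rule zero)
next
  case (update p m c)
  have "Poly_Mapping.update m c p = p + Poly_Mapping.single m c"
    using update(1)
    by (intro poly_mapping_eqI) (auto simp: lookup_update lookup_add lookup_single in_keys_iff)
  with add[OF update(3)] show ?case by simp
qed

lemma mpol_eval_mult:
  assumes "\<phi> 0 = 0" and "\<And>x y. \<phi> (x + y) = \<phi> x + \<phi> y" and "\<And>x y. \<phi> (x * y) = \<phi> x * \<phi> y"
  shows "mpol_eval \<phi> g (p * q) = mpol_eval \<phi> g p * mpol_eval \<phi> g q"
proof -
  have zero: "mpol_eval \<phi> g 0 = 0" by (simp add: mpol_eval_def)
  have single: "mpol_eval \<phi> g (Poly_Mapping.single m c * Poly_Mapping.single n d) =
      mpol_eval \<phi> g (Poly_Mapping.single m c) * mpol_eval \<phi> g (Poly_Mapping.single n d)" for m n c d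
    by (simp add: mult_single mpol_eval_single assms lookup_add power_add prod.distrib algebra_simps)
  have "mpol_eval \<phi> g (Poly_Mapping.single m c * q) =
      mpol_eval \<phi> g (Poly_Mapping.single m c) * mpol_eval \<phi> g q" for m c
    by (induction q rule: poly_mapping_add_induct)
      (simp_all add: zero single distrib_left mpol_eval_add[where \<phi> = \<phi>] assms(1,2))
  then show ?thesis
    by (induction p rule: poly_mapping_add_induct)
      (simp_all add: zero distrib_right mpol_eval_add[where \<phi> = \<phi>] assms(1,2))
qed

lemma mpol_induct [case_names const var add mult]:
  fixes p :: "('l, 'k::comm_semiring_1) mpol"
  assumes const: "\<And>c. Q (mpol_const c)" and var: "\<And>\<alpha>. Q (mpol_var \<alpha>)"
    and add: "\<And>p q. Q p \<Longrightarrow> Q q \<Longrightarrow> Q (p + q)" and mult: "\<And>p q. Q p \<Longrightarrow> Q q \<Longrightarrow> Q (p * q)"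
  shows "Q p"
proof -
  have zero: "Q 0" using const[of 0] by (simp add: mpol_const_def)
  have power: "Q (Poly_Mapping.single (Poly_Mapping.single \<alpha> n) 1)" for \<alpha> n
  proof (induction n)
    case 0
    then show ?case using const[of 1] by (simp add: mpol_const_def)
  next
    case (Suc n)
    have "Poly_Mapping.single (Poly_Mapping.single \<alpha> (Suc n)) 1 =
        mpol_var \<alpha> * Poly_Mapping.single (Poly_Mapping.single \<alpha> n) (1::'k)"
      by (simp add: mpol_var_def mult_single flip: single_add)
    then show ?case using mult[OF var Suc] by simp
  qed
  have monomial: "Q (Poly_Mapping.single m c)" for m c
  proof (induction m rule: poly_mapping_add_induct)
    case zero
    then show ?case using const[of c] by (simp add: mpol_const_def)
  next
    case (add m \<alpha> n)
    have "Poly_Mapping.single (m + Poly_Mapping.single \<alpha> n) c =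
        Poly_Mapping.single m c * Poly_Mapping.single (Poly_Mapping.single \<alpha> n) 1"
      by (simp add: mult_single)
    then show ?case using mult[OF add power] by simp
  qed
  show ?thesis
    by (induction p rule: poly_mapping_add_induct) (auto intro: zero add monomial)
qed

lemma mpol_const_simps:
  "mpol_const 0 = 0" "mpol_const 1 = 1" "mpol_const (c + d) = mpol_const c + mpol_const d"
  "mpol_const (c * d) = mpol_const c * mpol_const d"
  for c d :: "'k::comm_semiring_1"
  by (simp_all add: mpol_const_def single_add mult_single)

lemmas value_const = mpol_eval_const[of "\<lambda>c. c", simplified]
  and value_var = mpol_eval_var[of "\<lambda>c. c", simplified]
  and value_add = mpol_eval_add[of "\<lambda>c. c", simplified]
  and value_mult = mpol_eval_mult[of "\<lambda>c. c", simplified]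

lemma value_diff:
  fixes p q :: "('l::finite, 'k::comm_ring_1) mpol"
  shows "mpol_eval (\<lambda>c. c) P (p - q) = mpol_eval (\<lambda>c. c) P p - mpol_eval (\<lambda>c. c) P q"
  using value_add[of P "p - q" q] by (simp add: algebra_simps)

text \<open>
  The first-order Taylor expansion at \<open>P\<close> as an induction rule: the ideal of the polynomials
  vanishing at \<open>P\<close> is spanned over \<open>K\<close> by the \<open>X\<^sub>\<alpha> - P\<^sub>\<alpha>\<close> and by the products of two of its
  elements, since \<open>p - p(P)\<close> is such a combination for constants and variables, and
  \<open>pq - p(P) q(P) = (p - p(P)) (q - q(P)) + p(P) (q - q(P)) + q(P) (p - p(P))\<close>.
\<close>

lemma vanishing_induct:
  fixes P :: "'l::finite \<Rightarrow> 'k::comm_ring_1" and U :: "('l, 'k) mpol set"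
  assumes zero: "0 \<in> U"
    and add: "\<And>p q. p \<in> U \<Longrightarrow> q \<in> U \<Longrightarrow> p + q \<in> U"
    and scale: "\<And>c p. p \<in> U \<Longrightarrow> mpol_const c * p \<in> U"
    and mult: "\<And>p q. mpol_eval (\<lambda>c. c) P p = 0 \<Longrightarrow> mpol_eval (\<lambda>c. c) P q = 0 \<Longrightarrow> p * q \<in> U"
    and var: "\<And>\<alpha>. mpol_var \<alpha> - mpol_const (P \<alpha>) \<in> U"
    and p: "mpol_eval (\<lambda>c. c) P p = 0"
  shows "p \<in> U"
proof -
  let ?v = "\<lambda>p. mpol_const (mpol_eval (\<lambda>c. c) P p)"
  have "p - ?v p \<in> U" for p
  proof (induction p rule: mpol_induct)
    case (const c)
    then show ?case by (simp add: value_const zero)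
  next
    case (var \<alpha>)
    then show ?case using assms(5) by (simp add: value_var)
  next
    case (add p q)
    have "p + q - ?v (p + q) = (p - ?v p) + (q - ?v q)"
      by (simp add: value_add mpol_const_simps)
    then show ?case using assms(2)[OF add] by (simp only:)
  next
    case (mult p q)
    have "p * q - ?v (p * q) = (p - ?v p) * (q - ?v q) + ?v p * (q - ?v q) + ?v q * (p - ?v p)"
      by (simp add: value_mult mpol_const_simps algebra_simps)
    moreover have "(p - ?v p) * (q - ?v q) \<in> U"
      by (rule assms(4)) (simp_all add: value_diff value_const)
    ultimately show ?case using assms(2,3) mult by simp
  qed
  from this[of p] p show ?thesis by (simp add: mpol_const_simps)
qed

section \<open>Derivations at a point\<close>

text \<open>
  The derivative at the point \<open>P\<close> in the direction \<open>l\<close>, read off from the substitution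
  \<open>X\<^sub>\<alpha> \<mapsto> P\<^sub>\<alpha> + l\<^sub>\<alpha> t\<close> into \<open>K[t]\<close>.  Substitution being a ring homomorphism, the Leibniz rule
  comes for free.
\<close>

definition derivation :: "('l::finite \<Rightarrow> 'k::comm_ring_1) \<Rightarrow> ('l \<Rightarrow> 'k) \<Rightarrow> ('l, 'k) mpol \<Rightarrow> 'k" where
  "derivation P l p = poly.coeff (mpol_eval (\<lambda>c. [:c:]) (\<lambda>\<alpha>. [:P \<alpha>, l \<alpha>:]) p) 1"

lemma derivation_const [simp]: "derivation P l (mpol_const c) = 0"
  by (simp add: derivation_def mpol_eval_const)

lemma derivation_var [simp]: "derivation P l (mpol_var \<alpha>) = l \<alpha>"
  by (simp add: derivation_def mpol_eval_var one_pCons)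

lemma derivation_add: "derivation P l (p + q) = derivation P l p + derivation P l q"
  by (simp add: derivation_def mpol_eval_add)

lemma derivation_mult:
  "derivation P l (p * q) =
    mpol_eval (\<lambda>c. c) P p * derivation P l q + derivation P l p * mpol_eval (\<lambda>c. c) P q"
proof -
  let ?e = "mpol_eval (\<lambda>c. [:c:]) (\<lambda>\<alpha>. [:P \<alpha>, l \<alpha>:])"
  have mult: "?e (p * q) = ?e p * ?e q" for p q
    by (intro mpol_eval_mult) simp_all
  have coeff0: "poly.coeff (?e p) 0 = mpol_eval (\<lambda>c. c) P p" for p
    by (induction p rule: mpol_induct)
      (simp_all add: mpol_eval_const mpol_eval_var mpol_eval_add value_mult mult coeff_mult
        one_pCons value_const value_var value_add)
  show ?thesis
    by (simp add: derivation_def mult coeff_mult flip: coeff0)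
qed

lemma derivation_diff: "derivation P l (p - q) = derivation P l p - derivation P l q"
  using derivation_add[of P l "p - q" q] by (simp add: algebra_simps)

section \<open>The coordinate ring and the cotangent space\<close>

abbreviation mpol_ring :: "('l, 'k::field) mpol ring" where
  "mpol_ring \<equiv> ring_of_type_algebra"

lemma mpol_ring_simps:
  "carrier mpol_ring = UNIV" "p \<otimes>\<^bsub>mpol_ring\<^esub> q = p * q" "p \<oplus>\<^bsub>mpol_ring\<^esub> q = p + q"
  "\<one>\<^bsub>mpol_ring\<^esub> = 1" "\<zero>\<^bsub>mpol_ring\<^esub> = 0"
  by (simp_all add: ring_of_type_algebra_def)

lemma cring_mpol_ring: "cring mpol_ring"
  by (rule cring_from_type_algebra)

lemma mpol_ring_minus: "\<ominus>\<^bsub>mpol_ring\<^esub> p = - p"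
proof -
  interpret cring mpol_ring by (rule cring_mpol_ring)
  show ?thesis by (rule minus_equality) (simp_all add: mpol_ring_simps)
qed

lemma ideal_hibi_ideal: "ideal (hibi_ideal :: ('l::{finite,distrib_lattice}, 'k::field) mpol set) mpol_ring"
proof -
  interpret cring "mpol_ring :: ('l, 'k) mpol ring" by (rule cring_mpol_ring)
  show ?thesis unfolding hibi_ideal_def by (rule genideal_ideal) (simp add: mpol_ring_simps)
qed

lemma hibi_relation_in_ideal:
  "mpol_var a * mpol_var b - mpol_var (sup a b) * mpol_var (inf a b) \<in> hibi_ideal"
proof -
  interpret cring "mpol_ring :: ('a, 'b) mpol ring" by (rule cring_mpol_ring)
  have "{mpol_var \<alpha> * mpol_var \<beta> - mpol_var (sup \<alpha> \<beta>) * mpol_var (inf \<alpha> \<beta>) | \<alpha> \<beta>. True}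
      \<subseteq> (hibi_ideal :: ('a, 'b) mpol set)"
    unfolding hibi_ideal_def by (rule genideal_self) (simp add: mpol_ring_simps)
  then show ?thesis by blast
qed

lemma hibi_class_hom:
  "ring_hom_cring mpol_ring hibi_ring (hibi_class :: ('l::{finite,distrib_lattice}, 'k::field) mpol \<Rightarrow> _)"
  unfolding hibi_ring_def hibi_class_def[abs_def]
  by (rule ideal.rcos_ring_hom_cring[OF ideal_hibi_ideal cring_mpol_ring])

lemma coset_eq_iff:
  assumes "ideal I R" and "x \<in> carrier R" "y \<in> carrier R"
  shows "I +>\<^bsub>R\<^esub> x = I +>\<^bsub>R\<^esub> y \<longleftrightarrow> x \<ominus>\<^bsub>R\<^esub> y \<in> I"
  using ring.quotient_eq_iff_same_a_r_cos[OF ideal.axioms(2)[OF assms(1)] assms] by blast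

lemma hibi_class_eq_iff: "hibi_class p = hibi_class q \<longleftrightarrow> p - q \<in> hibi_ideal"
  unfolding hibi_class_def
  by (subst coset_eq_iff[OF ideal_hibi_ideal])
    (simp_all add: mpol_ring_simps a_minus_def mpol_ring_minus)

lemma carrier_hibi_ring: "carrier hibi_ring = range hibi_class"
  by (auto simp: hibi_ring_def hibi_class_def FactRing_def A_RCOSETS_def' mpol_ring_simps)

lemma hibi_class_simps:
  fixes p q :: "('l::{finite,distrib_lattice}, 'k::field) mpol"
  shows
  "hibi_class p \<oplus>\<^bsub>hibi_ring\<^esub> hibi_class q = hibi_class (p + q)"
  "hibi_class p \<otimes>\<^bsub>hibi_ring\<^esub> hibi_class q = hibi_class (p * q)"
  "\<zero>\<^bsub>hibi_ring\<^esub> = (hibi_class 0 :: ('l, 'k) mpol set)" "\<one>\<^bsub>hibi_ring\<^esub> = (hibi_class 1 :: ('l, 'k) mpol set)"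
  "\<ominus>\<^bsub>hibi_ring\<^esub> hibi_class p = hibi_class (- p)"
  "hibi_class p \<ominus>\<^bsub>hibi_ring\<^esub> hibi_class q = hibi_class (p - q)"
proof -
  interpret h: ring_hom_cring mpol_ring hibi_ring "hibi_class :: ('l, 'k) mpol \<Rightarrow> _" by (rule hibi_class_hom)
  note [simp] = mpol_ring_simps mpol_ring_minus
  show add: "hibi_class p \<oplus>\<^bsub>hibi_ring\<^esub> hibi_class q = hibi_class (p + q)" for p q :: "('l, 'k) mpol"
    using h.hom_add[of p q] by simp
  show "hibi_class p \<otimes>\<^bsub>hibi_ring\<^esub> hibi_class q = hibi_class (p * q)" using h.hom_mult[of p q] by simp
  show "\<zero>\<^bsub>hibi_ring\<^esub> = (hibi_class 0 :: ('l, 'k) mpol set)"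
    using h.hom_zero by simp
  show "\<one>\<^bsub>hibi_ring\<^esub> = (hibi_class 1 :: ('l, 'k) mpol set)" using h.hom_one by simp
  show uminus: "\<ominus>\<^bsub>hibi_ring\<^esub> hibi_class q = hibi_class (- q)" for q :: "('l, 'k) mpol"
    using h.hom_a_inv[of q] by simp
  show "hibi_class p \<ominus>\<^bsub>hibi_ring\<^esub> hibi_class q = hibi_class (p - q)"
    by (simp add: a_minus_def uminus add)
qed

lemma cring_hibi_ring: "cring hibi_ring"
  using hibi_class_hom unfolding ring_hom_cring_def by blast

lemma ideal_maximal_ideal_at:
  fixes P :: "'l::{finite,distrib_lattice} \<Rightarrow> 'k::field"
  shows "ideal (maximal_ideal_at P) hibi_ring"
proof (rule idealI)
  interpret R: cring "hibi_ring :: ('l, 'k) mpol set ring" by (rule cring_hibi_ring)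
  show "ring (hibi_ring :: ('l, 'k) mpol set ring)" by (rule R.ring_axioms)
  show "subgroup (maximal_ideal_at P) (add_monoid hibi_ring)"
  proof (rule R.add.subgroupI)
    show "maximal_ideal_at P \<subseteq> carrier hibi_ring"
      by (auto simp: maximal_ideal_at_def carrier_hibi_ring)
    have "mpol_eval (\<lambda>c. c) P 0 = 0" by (simp add: mpol_eval_def)
    then show "maximal_ideal_at P \<noteq> {}" unfolding maximal_ideal_at_def by blast
  next
    fix x assume "x \<in> maximal_ideal_at P"
    then show "\<ominus>\<^bsub>hibi_ring\<^esub> x \<in> maximal_ideal_at P"
      using value_diff[of P 0] by (force simp: maximal_ideal_at_def hibi_class_simps mpol_eval_def)
  next
    fix x y assume "x \<in> maximal_ideal_at P" "y \<in> maximal_ideal_at P"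
    then show "x \<oplus>\<^bsub>hibi_ring\<^esub> y \<in> maximal_ideal_at P"
      by (auto simp: maximal_ideal_at_def hibi_class_simps value_add intro!: imageI)
  qed
next
  fix x r :: "('l, 'k) mpol set" assume "x \<in> maximal_ideal_at P" "r \<in> carrier hibi_ring"
  then show "r \<otimes>\<^bsub>hibi_ring\<^esub> x \<in> maximal_ideal_at P" "x \<otimes>\<^bsub>hibi_ring\<^esub> r \<in> maximal_ideal_at P"
    by (auto simp: maximal_ideal_at_def carrier_hibi_ring hibi_class_simps value_mult intro!: imageI)
qed

abbreviation square_at :: "('l::{finite,distrib_lattice} \<Rightarrow> 'k::field) \<Rightarrow> ('l, 'k) mpol set set" where
  "square_at P \<equiv> ideal_prod hibi_ring (maximal_ideal_at P) (maximal_ideal_at P)"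

lemma ideal_square_at: "ideal (square_at P) hibi_ring"
  by (rule ring.ideal_prod_is_ideal[OF cring.axioms(1)[OF cring_hibi_ring]
      ideal_maximal_ideal_at ideal_maximal_ideal_at])

text \<open>
  Cotangent vectors are handled through polynomials: every one of them is \<open>cot_class P p\<close> for a
  polynomial \<open>p\<close> vanishing at \<open>P\<close>, and \<open>second_order P\<close> collects the polynomials that become zero.
  This reduces computations in a quotient of a quotient to congruences between polynomials.
\<close>

definition cot_class ::
    "('l::{finite,distrib_lattice} \<Rightarrow> 'k::field) \<Rightarrow> ('l, 'k) mpol \<Rightarrow> ('l, 'k) mpol set set" where
  "cot_class P p = square_at P +>\<^bsub>hibi_ring\<^esub> hibi_class p"

definition second_order :: "('l::{finite,distrib_lattice} \<Rightarrow> 'k::field) \<Rightarrow> ('l, 'k) mpol set" where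
  "second_order P = {p. hibi_class p \<in> square_at P}"

lemma cot_class_eq_iff: "cot_class P p = cot_class P q \<longleftrightarrow> p - q \<in> second_order P"
  unfolding cot_class_def second_order_def
  by (subst coset_eq_iff[OF ideal_square_at]) (simp_all add: carrier_hibi_ring hibi_class_simps)

lemma second_order_product:
  "mpol_eval (\<lambda>c. c) P p = 0 \<Longrightarrow> mpol_eval (\<lambda>c. c) P q = 0 \<Longrightarrow> p * q \<in> second_order P"
  unfolding second_order_def
  by (auto simp: maximal_ideal_at_def simp flip: hibi_class_simps(2) intro!: ideal_prod.prod)

lemma second_order_ideal:
  "0 \<in> second_order P" "p \<in> second_order P \<Longrightarrow> q \<in> second_order P \<Longrightarrow> p + q \<in> second_order P"
  "p \<in> second_order P \<Longrightarrow> r * p \<in> second_order P" "p \<in> second_order P \<Longrightarrow> - p \<in> second_order P"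
proof -
  interpret ideal "square_at P" hibi_ring by (rule ideal_square_at)
  show "0 \<in> second_order P"
    using zero_closed by (simp add: second_order_def flip: hibi_class_simps(3))
  show "p \<in> second_order P \<Longrightarrow> q \<in> second_order P \<Longrightarrow> p + q \<in> second_order P"
    by (simp add: second_order_def flip: hibi_class_simps(1))
  show mult: "r * p \<in> second_order P" if "p \<in> second_order P" for r
    using that I_l_closed[of "hibi_class p" "hibi_class r"]
    by (simp add: second_order_def carrier_hibi_ring flip: hibi_class_simps(2))
  show "- p \<in> second_order P" if "p \<in> second_order P"
    using mult[OF that, of "- 1"] by simp
qed

lemma hibi_ideal_subset_second_order: "hibi_ideal \<subseteq> second_order P"
proof
  fix p assume "p \<in> (hibi_ideal :: ('a, 'b) mpol set)"
  then have "hibi_class p = hibi_class 0" by (simp add: hibi_class_eq_iff)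
  then show "p \<in> second_order P"
    using second_order_ideal(1)[of P] by (simp add: second_order_def)
qed

lemma hibi_cotangent_simps:
  "carrier (hibi_cotangent P) = cot_class P ` {p. mpol_eval (\<lambda>c. c) P p = 0}"
  "\<zero>\<^bsub>hibi_cotangent P\<^esub> = cot_class P 0"
  "cot_class P p \<oplus>\<^bsub>hibi_cotangent P\<^esub> cot_class P q = cot_class P (p + q)"
  "c \<odot>\<^bsub>hibi_cotangent P\<^esub> cot_class P p = cot_class P (mpol_const c * p)"
proof -
  interpret h: ring_hom_cring hibi_ring "FactRing hibi_ring (square_at P)" "(+>\<^bsub>hibi_ring\<^esub>) (square_at P)"
    by (rule ideal.rcos_ring_hom_cring[OF ideal_square_at cring_hibi_ring])
  note defs = hibi_cotangent_def cotangent_space_def Let_def cot_class_def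
  show "carrier (hibi_cotangent P) = cot_class P ` {p. mpol_eval (\<lambda>c. c) P p = 0}"
    by (auto simp: defs maximal_ideal_at_def)
  show "\<zero>\<^bsub>hibi_cotangent P\<^esub> = cot_class P 0"
    using h.hom_zero by (simp add: defs hibi_class_simps)
  show "cot_class P p \<oplus>\<^bsub>hibi_cotangent P\<^esub> cot_class P q = cot_class P (p + q)"
    using h.hom_add[of "hibi_class p" "hibi_class q"] by (simp add: defs hibi_class_simps carrier_hibi_ring)
  show "c \<odot>\<^bsub>hibi_cotangent P\<^esub> cot_class P p = cot_class P (mpol_const c * p)"
    using h.hom_mult[of "hibi_class (mpol_const c)" "hibi_class p"]
    by (simp add: defs hibi_class_simps carrier_hibi_ring)
qed

lemma vectorspace_hibi_cotangent:
  fixes P :: "'l::{finite,distrib_lattice} \<Rightarrow> 'k::field"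
  shows "vectorspace ring_of_type_algebra (hibi_cotangent P)"
proof -
  interpret K: field "ring_of_type_algebra :: 'k ring" by (rule field_from_type_algebra)
  let ?V = "hibi_cotangent P"
  have K_simps: "carrier (ring_of_type_algebra :: 'k ring) = UNIV"
      "\<And>x y. x \<otimes>\<^bsub>ring_of_type_algebra\<^esub> y = (x * y :: 'k)"
      "\<And>x y. x \<oplus>\<^bsub>ring_of_type_algebra\<^esub> y = (x + y :: 'k)" "\<one>\<^bsub>ring_of_type_algebra\<^esub> = (1 :: 'k)"
    by (simp_all add: ring_of_type_algebra_def)
  have V: thesis if "x \<in> carrier ?V"
      and "\<And>p. x = cot_class P p \<Longrightarrow> mpol_eval (\<lambda>c. c) P p = 0 \<Longrightarrow> thesis" for x thesis
    using that by (auto simp: hibi_cotangent_simps(1))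
  have closed: "cot_class P p \<in> carrier ?V" if "mpol_eval (\<lambda>c. c) P p = 0" for p
    using that by (simp add: hibi_cotangent_simps(1))
  have value_zero: "mpol_eval (\<lambda>c. c) P 0 = 0" by (simp add: mpol_eval_def)
  have value_minus: "mpol_eval (\<lambda>c. c) P (- p) = - mpol_eval (\<lambda>c. c) P p" for p
    using value_diff[of P 0 p] by (simp add: value_zero)
  note simps = hibi_cotangent_simps(2-4) mpol_const_simps
  have "abelian_group ?V"
  proof (rule abelian_groupI)
    fix x assume x: "x \<in> carrier ?V"
    then obtain p where "x = cot_class P p" "mpol_eval (\<lambda>c. c) P p = 0" by (rule V)
    then show "\<exists>y\<in>carrier ?V. y \<oplus>\<^bsub>?V\<^esub> x = \<zero>\<^bsub>?V\<^esub>"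
      by (intro bexI[of _ "cot_class P (- p)"]) (simp_all add: simps closed value_minus)
  qed (auto elim!: V simp: simps algebra_simps intro!: closed simp: value_add value_zero)
  moreover have "module_axioms ring_of_type_algebra ?V"
    by unfold_locales
      (auto elim!: V simp: simps K_simps algebra_simps intro!: closed simp: value_mult)
  ultimately show ?thesis
    by (intro vectorspace.intro module.intro K.is_cring field_from_type_algebra)
qed

section \<open>Tangent vectors as linear forms\<close>

text \<open>
  The equations cut out by the differentials of the binomials \<open>X\<^sub>a X\<^sub>b - X\<^sub>s X\<^sub>i\<close> at \<open>P\<close>, where \<open>s\<close> and
  \<open>i\<close> are join and meet of \<open>a\<close> and \<open>b\<close>.
\<close>

definition tangent_vector :: "('l::lattice \<Rightarrow> 'k::comm_ring_1) \<Rightarrow> ('l \<Rightarrow> 'k) \<Rightarrow> bool" where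
  "tangent_vector P l \<longleftrightarrow>
     (\<forall>a b. P a * l b + P b * l a = P (sup a b) * l (inf a b) + P (inf a b) * l (sup a b))"

text \<open>
  Tangent vectors give linear forms on the cotangent space.  Polynomials \<open>p\<close> with \<open>p(P) = 0\<close> and
  vanishing derivative in direction \<open>l\<close> form an ideal by the Leibniz rule, so only the generators of
  the Hibi ideal matter.  They vanish at \<open>P\<close> because \<open>P\<close> lies on the variety, and the derivative of a
  generator is exactly the defining equation of a tangent vector.
\<close>

lemma derivation_vanishes_on_hibi_ideal:
  fixes P :: "'l::{finite,distrib_lattice} \<Rightarrow> 'k::field"
  assumes point: "\<And>a b. P a * P b = P (sup a b) * P (inf a b)" and l: "tangent_vector P l"
    and p: "p \<in> hibi_ideal"
  shows "derivation P l p = 0"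
proof -
  let ?v = "mpol_eval (\<lambda>c. c) P"
  let ?Z = "{p. ?v p = 0 \<and> derivation P l p = 0}"
  interpret A: cring "mpol_ring :: ('l, 'k) mpol ring" by (rule cring_mpol_ring)
  have zero: "?v 0 = 0" "derivation P l 0 = 0" by (simp_all add: mpol_eval_def derivation_def)
  have minus: "?v (- p) = - ?v p" "derivation P l (- p) = - derivation P l p" for p
    using value_diff[of P 0 p] derivation_diff[of P l 0 p] by (simp_all add: zero)
  have "ideal ?Z mpol_ring"
  proof (rule idealI)
    show "subgroup ?Z (add_monoid mpol_ring)"
    proof (rule A.add.subgroupI)
      show "?Z \<noteq> {}" using zero by blast
    qed (simp_all add: mpol_ring_simps mpol_ring_minus value_add derivation_add minus)
  qed (simp_all add: A.ring_axioms mpol_ring_simps value_mult derivation_mult)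
  moreover have "{mpol_var \<alpha> * mpol_var \<beta> - mpol_var (sup \<alpha> \<beta>) * mpol_var (inf \<alpha> \<beta>) | \<alpha> \<beta>. True} \<subseteq> ?Z"
  proof -
    have "mpol_var a * mpol_var b - mpol_var (sup a b) * mpol_var (inf a b) \<in> ?Z" for a b
      using l[unfolded tangent_vector_def, rule_format, of a b] point[of a b]
      by (simp add: value_diff value_mult value_var derivation_diff derivation_mult ac_simps)
    then show ?thesis by blast
  qed
  ultimately have "hibi_ideal \<subseteq> ?Z"
    unfolding hibi_ideal_def by (rule A.genideal_minimal)
  with p show ?thesis by blast
qed

lemma derivation_vanishes_on_second_order:
  fixes P :: "'l::{finite,distrib_lattice} \<Rightarrow> 'k::field"
  assumes point: "\<And>a b. P a * P b = P (sup a b) * P (inf a b)" and l: "tangent_vector P l"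
    and p: "p \<in> second_order P"
  shows "derivation P l p = 0"
proof -
  have "\<exists>q. x = hibi_class q \<and> derivation P l q = 0" if "x \<in> square_at P" for x
    using that
  proof (induction rule: ideal_prod.induct)
    case (prod i j)
    then obtain q r where "i = hibi_class q" "j = hibi_class r"
        "mpol_eval (\<lambda>c. c) P q = 0" "mpol_eval (\<lambda>c. c) P r = 0"
      by (auto simp: maximal_ideal_at_def)
    then show ?case
      by (intro exI[of _ "q * r"]) (simp add: hibi_class_simps derivation_mult)
  next
    case (sum x y)
    then obtain q r where "x = hibi_class q" "y = hibi_class r"
        "derivation P l q = 0" "derivation P l r = 0" by blast
    then show ?case
      by (intro exI[of _ "q + r"]) (simp add: hibi_class_simps derivation_add)
  qed
  then obtain q where "hibi_class p = hibi_class q" "derivation P l q = 0"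
    using p unfolding second_order_def by blast
  moreover from this have "derivation P l (p - q) = 0"
    by (intro derivation_vanishes_on_hibi_ideal[OF point l]) (simp add: hibi_class_eq_iff)
  ultimately show ?thesis by (simp add: derivation_diff)
qed

text \<open>
  The linear form on the cotangent space induced by a derivation; for a tangent vector the choice of
  the representing polynomial does not matter.
\<close>

definition cot_functional ::
    "('l::{finite,distrib_lattice} \<Rightarrow> 'k::field) \<Rightarrow> ('l \<Rightarrow> 'k) \<Rightarrow> ('l, 'k) mpol set set \<Rightarrow> 'k" where
  "cot_functional P l x = derivation P l (SOME p. cot_class P p = x)"

lemma cot_functional_cot_class:
  assumes "\<And>a b. P a * P b = P (sup a b) * P (inf a b)" and "tangent_vector P l"
  shows "cot_functional P l (cot_class P p) = derivation P l p"
proof -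
  define q where "q = (SOME q. cot_class P q = cot_class P p)"
  have "cot_class P q = cot_class P p" unfolding q_def by (rule someI) (rule refl)
  then have "derivation P l (q - p) = 0"
    by (intro derivation_vanishes_on_second_order[OF assms]) (simp add: cot_class_eq_iff)
  then show ?thesis by (simp add: cot_functional_def q_def[symmetric] derivation_diff)
qed

text \<open>
  A family with biorthogonal linear forms is independent: applying the form of index \<open>i\<close> to a linear
  relation isolates the coefficient at \<open>i\<close>.  Stating this for a family rather than for a set gives
  injectivity of the family as well, and hence, for a family indexed by a disjoint sum, disjointness of
  its two halves.
\<close>

lemma (in vectorspace) dual_family_independent:
  fixes F :: "'i \<Rightarrow> _" and f :: "'i \<Rightarrow> _ \<Rightarrow> 'a"
  assumes F: "\<And>i. i \<in> I \<Longrightarrow> F i \<in> carrier V"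
    and f_closed: "\<And>i x. i \<in> I \<Longrightarrow> x \<in> carrier V \<Longrightarrow> f i x \<in> carrier K"
    and f_add: "\<And>i x y. i \<in> I \<Longrightarrow> x \<in> carrier V \<Longrightarrow> y \<in> carrier V \<Longrightarrow> f i (x \<oplus>\<^bsub>V\<^esub> y) = f i x \<oplus>\<^bsub>K\<^esub> f i y"
    and f_smult: "\<And>i c x. i \<in> I \<Longrightarrow> c \<in> carrier K \<Longrightarrow> x \<in> carrier V \<Longrightarrow> f i (c \<odot>\<^bsub>V\<^esub> x) = c \<otimes>\<^bsub>K\<^esub> f i x"
    and diag: "\<And>i. i \<in> I \<Longrightarrow> f i (F i) \<noteq> \<zero>\<^bsub>K\<^esub>"
    and off_diag: "\<And>i j. i \<in> I \<Longrightarrow> j \<in> I \<Longrightarrow> i \<noteq> j \<Longrightarrow> f i (F j) = \<zero>\<^bsub>K\<^esub>"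
  shows "inj_on F I \<and> lin_indpt (F ` I)"
proof
  show "inj_on F I"
  proof (rule inj_onI, rule ccontr)
    fix i j assume "i \<in> I" "j \<in> I" "F i = F j" "i \<noteq> j"
    then show False using diag[of i] off_diag[of i j] by simp
  qed
  have zero: "f i \<zero>\<^bsub>V\<^esub> = \<zero>\<^bsub>K\<^esub>" if "i \<in> I" for i
    using f_smult[OF that, of "\<zero>\<^bsub>K\<^esub>" "\<zero>\<^bsub>V\<^esub>"] f_closed[OF that, of "\<zero>\<^bsub>V\<^esub>"] by simp
  have vanish: "f i (lincomb a B) = \<zero>\<^bsub>K\<^esub>"
    if "i \<in> I" "finite B" "B \<subseteq> carrier V" "a \<in> B \<rightarrow> carrier K" "\<And>x. x \<in> B \<Longrightarrow> f i x = \<zero>\<^bsub>K\<^esub>" for i a B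
    using that(2-)
  proof (induction B rule: finite_induct)
    case empty
    then show ?case by (simp add: lincomb_def zero that(1))
  next
    case (insert x B)
    have "lincomb a (insert x B) = a x \<odot>\<^bsub>V\<^esub> x \<oplus>\<^bsub>V\<^esub> lincomb a B"
      using insert.prems insert.hyps by (intro lincomb_insert2) auto
    moreover have "x \<in> carrier V" "a x \<in> carrier K" "lincomb a B \<in> carrier V"
      using insert.prems by auto
    moreover have "f i (lincomb a B) = \<zero>\<^bsub>K\<^esub>" using insert by auto
    ultimately show ?case using that(1) insert.prems(3) by (simp add: f_add f_smult)
  qed
  show "lin_indpt (F ` I)"
  proof
    assume "lin_dep (F ` I)"
    then obtain A a v where A: "finite A" "A \<subseteq> F ` I" "a \<in> A \<rightarrow> carrier K"
        "lincomb a A = \<zero>\<^bsub>V\<^esub>" "v \<in> A" "a v \<noteq> \<zero>\<^bsub>K\<^esub>"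
      unfolding lin_dep_def by blast
    then obtain i where i: "i \<in> I" "v = F i" by blast
    have A_carrier: "A \<subseteq> carrier V" using A(2) F by blast
    have av: "a v \<in> carrier K" "v \<in> carrier V" using A(3,5) A_carrier by auto
    have "lincomb a A = a v \<odot>\<^bsub>V\<^esub> v \<oplus>\<^bsub>V\<^esub> lincomb a (A - {v})"
      using A A_carrier by (intro lincomb_del2) auto
    moreover have "f i (lincomb a (A - {v})) = \<zero>\<^bsub>K\<^esub>"
    proof (rule vanish[OF i(1)])
      fix x assume "x \<in> A - {v}"
      then obtain j where "j \<in> I" "x = F j" "i \<noteq> j" using A(2) i(2) by blast
      then show "f i x = \<zero>\<^bsub>K\<^esub>" using off_diag i(1) by simp
    qed (use A A_carrier in auto)
    moreover have "lincomb a (A - {v}) \<in> carrier V"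
      using A A_carrier by (intro lincomb_closed) auto
    ultimately have "f i (lincomb a A) = a v \<otimes>\<^bsub>K\<^esub> f i v"
      using i(1) av f_closed[OF i(1) av(2)] by (simp add: f_add f_smult)
    with A(4) zero[OF i(1)] have "a v \<otimes>\<^bsub>K\<^esub> f i v = \<zero>\<^bsub>K\<^esub>" by simp
    then show False
      using A(6) diag[OF i(1)] i(2) integral[OF _ av(1) f_closed[OF i(1) av(2)]] by simp
  qed
qed

section \<open>The support of the point of a face\<close>

text \<open>
  The condition on \<open>D\<close> for its indicator function to satisfy \<open>P\<^sub>a P\<^sub>b = P\<^sub>s P\<^sub>i\<close>, that is, to be a
  point of the Hibi variety.
\<close>

definition two_sided_closed :: "'l::lattice set \<Rightarrow> bool" where
  "two_sided_closed D \<longleftrightarrow> (\<forall>a b. a \<in> D \<and> b \<in> D \<longleftrightarrow> sup a b \<in> D \<and> inf a b \<in> D)"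

lemma two_sided_closedD:
  assumes "two_sided_closed D"
  shows "a \<in> D \<Longrightarrow> b \<in> D \<Longrightarrow> sup a b \<in> D" "a \<in> D \<Longrightarrow> b \<in> D \<Longrightarrow> inf a b \<in> D"
    "sup a b \<in> D \<Longrightarrow> inf a b \<in> D \<Longrightarrow> a \<in> D"
  using assms unfolding two_sided_closed_def by blast+

lemma f_char_component: "f_char \<alpha> $ z = (if z \<in> irr_below \<alpha> then 1 else 0)"
  by (simp add: f_char_def axis_def sum.delta)

lemma join_irreducible_le_sup_iff:
  fixes z :: "'l::distrib_lattice"
  assumes "z \<in> join_irreducibles"
  shows "z \<le> sup a b \<longleftrightarrow> z \<le> a \<or> z \<le> b"
proof
  assume "z \<le> sup a b"
  then have "z = sup (inf z a) (inf z b)"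
    by (metis inf_absorb1 inf_sup_distrib1)
  with assms have "z = inf z a \<or> z = inf z b"
    unfolding join_irreducibles_def by blast
  then show "z \<le> a \<or> z \<le> b" by (metis inf_le2)
qed (auto intro: le_supI1 le_supI2)

lemma f_char_modular: "f_char (sup \<alpha> \<beta>) + f_char (inf \<alpha> \<beta>) = f_char \<alpha> + f_char \<beta>"
  by (auto simp: vec_eq_iff f_char_component irr_below_def join_irreducible_le_sup_iff)

lemma f_char_in_irr_space: "f_char \<alpha> \<in> irr_space"
  by (simp add: irr_space_def f_char_component irr_below_def)

text \<open>
  The torus embedding identifies \<open>X\<^sub>\<alpha>\<close> with the character \<open>f_char \<alpha>\<close>, which must therefore be an
  exponent of the semigroup algebra of the dual cone.
\<close>

lemma f_char_in_dual_cone: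
  assumes "is_hibi_cone TYPE('k::field) \<sigma>"
  shows "f_char \<alpha> \<in> dual_cone \<sigma>"
proof -
  have "torus_pullback (mpol_var \<alpha> :: ('a, 'k) mpol) = Poly_Mapping.single (f_char \<alpha>) 1"
  proof -
    have "(\<Prod>\<beta>\<in>UNIV. Poly_Mapping.single (f_char \<beta>) (1::'k) ^
            Poly_Mapping.lookup (Poly_Mapping.single \<alpha> 1) \<beta>)
        = (\<Prod>\<beta>\<in>UNIV. if \<beta> = \<alpha> then Poly_Mapping.single (f_char \<beta>) (1::'k) else 1)"
      by (intro prod.cong) (auto simp: lookup_single)
    then show ?thesis by (simp add: torus_pullback_def mpol_eval_def mpol_var_def)
  qed
  moreover have "torus_pullback (mpol_var \<alpha> :: ('a, 'k) mpol) \<in>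
      semigroup_algebra (dual_cone \<sigma> \<inter> irr_lattice)"
    using assms unfolding is_hibi_cone_def by blast
  ultimately show ?thesis by (simp add: semigroup_algebra_def)
qed

text \<open>
  At a vector of the face all \<open>f\<^sub>\<alpha>\<close> are nonnegative, so that each of the two equal sums
  \<open>f\<^sub>a + f\<^sub>b = f\<^sub>s + f\<^sub>i\<close>, with \<open>s\<close> and \<open>i\<close> join and meet of \<open>a\<close> and \<open>b\<close>, vanishes there if and only if
  both of its summands do.
\<close>

lemma face_support_two_sided_closed:
  fixes \<sigma> \<tau> :: "(real ^ 'l::{finite,distrib_lattice}) set"
  assumes "is_hibi_cone TYPE('k::field) \<sigma>" and "cone_face \<tau> \<sigma>"
  shows "two_sided_closed (point_support (face_point \<tau> :: 'l \<Rightarrow> 'k))"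
proof -
  have "\<tau> \<subseteq> \<sigma>" using assms(2) unfolding cone_face_def by blast
  then have nonneg: "0 \<le> f_char \<alpha> \<bullet> v" if "v \<in> \<tau>" for \<alpha> v
    using f_char_in_dual_cone[OF assms(1)] that unfolding dual_cone_def by blast
  have "(f_char a \<bullet> v = 0 \<and> f_char b \<bullet> v = 0) \<longleftrightarrow>
      (f_char (sup a b) \<bullet> v = 0 \<and> f_char (inf a b) \<bullet> v = 0)" if "v \<in> \<tau>" for a b :: 'l and v
  proof -
    have "f_char (sup a b) \<bullet> v + f_char (inf a b) \<bullet> v = f_char a \<bullet> v + f_char b \<bullet> v"
      by (metis f_char_modular inner_add_left)
    with nonneg[OF that, of a] nonneg[OF that, of b] nonneg[OF that, of "sup a b"]
      nonneg[OF that, of "inf a b"] show ?thesis by linarith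
  qed
  moreover have "\<alpha> \<in> point_support (face_point \<tau> :: 'l \<Rightarrow> 'k) \<longleftrightarrow> (\<forall>v\<in>\<tau>. f_char \<alpha> \<bullet> v = 0)" for \<alpha>
    by (simp add: point_support_def face_point_def perp_def f_char_in_irr_space)
  ultimately show ?thesis unfolding two_sided_closed_def by blast
qed

section \<open>Classes avoiding the set E\<close>

lemma mem_Lambda_set_iff:
  fixes \<Gamma> :: "'l::{finite,lattice} set"
  assumes "\<forall>x\<in>\<Gamma>. \<forall>y\<in>\<Gamma>. x \<le> y \<or> y \<le> x"
  shows "\<theta> \<in> Lambda_set \<Gamma> \<longleftrightarrow> (\<forall>\<gamma>\<in>\<Gamma>. \<theta> \<le> \<gamma> \<or> \<gamma> \<le> \<theta>)"
proof
  assume "\<theta> \<in> Lambda_set \<Gamma>"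
  then show "\<forall>\<gamma>\<in>\<Gamma>. \<theta> \<le> \<gamma> \<or> \<gamma> \<le> \<theta>"
    unfolding Lambda_set_def pred_on.maxchain_def pred_on.chain_def by force
next
  assume comparable: "\<forall>\<gamma>\<in>\<Gamma>. \<theta> \<le> \<gamma> \<or> \<gamma> \<le> \<theta>"
  \<comment> \<open>Extend \<open>insert \<theta> \<Gamma>\<close> to a maximal chain.\<close>
  let ?Q = "\<lambda>C. pred_on.chain UNIV (<) C \<and> insert \<theta> \<Gamma> \<subseteq> C"
  have "?Q (insert \<theta> \<Gamma>)"
    using assms comparable unfolding pred_on.chain_def by (auto simp: less_le)
  then obtain C where "?Q C" and max: "\<forall>C'. ?Q C' \<longrightarrow> C \<subseteq> C' \<longrightarrow> C = C'"
    using finite_has_maximal2[of "{C. ?Q C}" "insert \<theta> \<Gamma>"] by auto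
  then have "pred_on.maxchain UNIV (<) C"
    using max unfolding pred_on.maxchain_def by blast
  with \<open>?Q C\<close> show "\<theta> \<in> Lambda_set \<Gamma>"
    unfolding Lambda_set_def by blast
qed

lemma equiv_side_equiv: "equiv (- D) (side_equiv D)"
proof (rule equivI)
  have "sym (side_step D)"
    by (rule symI) (auto simp: side_step_def insert_commute)
  then have "sym ((side_step D)\<^sup>*)" by (rule sym_rtrancl)
  then show "sym (side_equiv D)"
    unfolding side_equiv_def sym_def by blast
  show "trans (side_equiv D)"
    unfolding side_equiv_def by (rule transI) (auto intro: rtrancl_trans)
qed (auto simp: side_equiv_def refl_on_def)

lemma side_stepI:
  assumes "diamond a b" and "({\<theta>, \<delta>}, S) \<in> opposite_sides a b" and "S \<subseteq> D" "\<theta> \<notin> D" "\<delta> \<notin> D"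
  shows "(\<theta>, \<delta>) \<in> side_equiv D"
  using assms unfolding side_equiv_def side_step_def by blast

lemma one_vertex_in_E:
  assumes "diamond a b" and "diamond_vertices a b \<inter> D = {\<beta>}"
    and "{\<alpha>, \<beta>} \<in> diamond_diagonals a b" and "\<alpha> \<notin> D"
  shows "\<alpha> \<in> E_set D"
  using assms unfolding E_set_def by blast

text \<open>
  If \<open>\<theta>\<close> is not comparable with \<open>\<gamma> \<in> \<Gamma>\<close>, then in the diamond spanned by them exactly one of join and
  meet lies in \<open>D\<close>: not both as \<open>\<theta> \<notin> D\<close>, and not neither as \<open>\<theta> \<notin> E_set D\<close>.  The other one is
  equivalent to \<open>\<theta>\<close>, is comparable with \<open>\<gamma>\<close>, and stays comparable with whatever element of the
  chain \<open>\<theta>\<close> was comparable with.  So the number of incomparable chain elements drops.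
\<close>

lemma class_meets_comparable:
  fixes D \<Gamma> :: "'l::{finite,distrib_lattice} set"
  assumes D: "two_sided_closed D" and \<Gamma>: "\<Gamma> \<subseteq> D" "\<forall>x\<in>\<Gamma>. \<forall>y\<in>\<Gamma>. x \<le> y \<or> y \<le> x"
    and "\<theta> \<notin> D" and "side_equiv D `` {\<theta>} \<inter> E_set D = {}"
  shows "\<exists>\<delta>\<in>Lambda_set \<Gamma>. (\<theta>, \<delta>) \<in> side_equiv D"
  using assms(4,5)
proof (induction "card {\<gamma>\<in>\<Gamma>. \<not> (\<theta> \<le> \<gamma> \<or> \<gamma> \<le> \<theta>)}" arbitrary: \<theta> rule: less_induct)
  case less
  have refl: "(\<theta>, \<theta>) \<in> side_equiv D"
    using less.prems(1) by (simp add: side_equiv_def)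
  show ?case
  proof (cases "\<theta> \<in> Lambda_set \<Gamma>")
    case True
    with refl show ?thesis by blast
  next
    case False
    then obtain \<gamma> where \<gamma>: "\<gamma> \<in> \<Gamma>" "\<not> \<theta> \<le> \<gamma>" "\<not> \<gamma> \<le> \<theta>"
      using mem_Lambda_set_iff[OF \<Gamma>(2)] by blast
    then have "\<gamma> \<in> D" using \<Gamma>(1) by blast
    have diamond: "diamond \<theta> \<gamma>" using \<gamma> by (simp add: diamond_def)
    have not_both: "\<not> (sup \<theta> \<gamma> \<in> D \<and> inf \<theta> \<gamma> \<in> D)"
      using less.prems(1) two_sided_closedD(3)[OF D] by blast
    have not_neither: "sup \<theta> \<gamma> \<in> D \<or> inf \<theta> \<gamma> \<in> D"
    proof (rule ccontr)
      assume "\<not> ?thesis"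
      then have "diamond_vertices \<theta> \<gamma> \<inter> D = {\<gamma>}"
        using less.prems(1) \<open>\<gamma> \<in> D\<close> by (auto simp: diamond_vertices_def)
      then have "\<theta> \<in> E_set D"
        using diamond less.prems(1) by (intro one_vertex_in_E) (auto simp: diamond_diagonals_def)
      with refl less.prems(2) show False by blast
    qed
    define \<delta> where "\<delta> = (if sup \<theta> \<gamma> \<in> D then inf \<theta> \<gamma> else sup \<theta> \<gamma>)"
    have "\<delta> \<notin> D" using not_both by (auto simp: \<delta>_def)
    have step: "(\<theta>, \<delta>) \<in> side_equiv D"
    proof (cases "sup \<theta> \<gamma> \<in> D")
      case True
      with diamond \<open>\<gamma> \<in> D\<close> \<open>\<delta> \<notin> D\<close> less.prems(1) show ?thesis
        by (intro side_stepI[of \<theta> \<gamma> _ _ "{\<gamma>, sup \<theta> \<gamma>}"]) (auto simp: \<delta>_def opposite_sides_def)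
    next
      case False
      with diamond \<open>\<gamma> \<in> D\<close> \<open>\<delta> \<notin> D\<close> not_neither less.prems(1) show ?thesis
        by (intro side_stepI[of \<theta> \<gamma> _ _ "{inf \<theta> \<gamma>, \<gamma>}"]) (auto simp: \<delta>_def opposite_sides_def)
    qed
    have comparable_\<gamma>: "\<delta> \<le> \<gamma> \<or> \<gamma> \<le> \<delta>" by (simp add: \<delta>_def)
    have comparable: "\<delta> \<le> \<epsilon> \<or> \<epsilon> \<le> \<delta>" if "\<epsilon> \<in> \<Gamma>" "\<theta> \<le> \<epsilon> \<or> \<epsilon> \<le> \<theta>" for \<epsilon>
    proof -
      have "inf \<theta> \<gamma> \<le> \<epsilon> \<or> \<epsilon> \<le> inf \<theta> \<gamma>"
        using bspec[OF bspec[OF \<Gamma>(2) that(1)] \<gamma>(1)] that(2) \<gamma>(3) by (metis le_inf_iff le_infI1 order_trans)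
      moreover have "sup \<theta> \<gamma> \<le> \<epsilon> \<or> \<epsilon> \<le> sup \<theta> \<gamma>"
        using bspec[OF bspec[OF \<Gamma>(2) that(1)] \<gamma>(1)] that(2) \<gamma>(2) by (metis le_sup_iff le_supI1 order_trans)
      ultimately show ?thesis by (simp add: \<delta>_def)
    qed
    have "{\<epsilon>\<in>\<Gamma>. \<not> (\<delta> \<le> \<epsilon> \<or> \<epsilon> \<le> \<delta>)} \<subset> {\<epsilon>\<in>\<Gamma>. \<not> (\<theta> \<le> \<epsilon> \<or> \<epsilon> \<le> \<theta>)}"
      using comparable comparable_\<gamma> \<gamma> by blast
    then have "card {\<epsilon>\<in>\<Gamma>. \<not> (\<delta> \<le> \<epsilon> \<or> \<epsilon> \<le> \<delta>)} < card {\<epsilon>\<in>\<Gamma>. \<not> (\<theta> \<le> \<epsilon> \<or> \<epsilon> \<le> \<theta>)}"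
      by (intro psubset_card_mono) auto
    moreover have class_eq: "side_equiv D `` {\<delta>} = side_equiv D `` {\<theta>}"
      using equiv_class_eq[OF equiv_side_equiv step] by simp
    ultimately obtain \<eta> where "\<eta> \<in> Lambda_set \<Gamma>" "(\<delta>, \<eta>) \<in> side_equiv D"
      using less.hyps[of \<delta>] \<open>\<delta> \<notin> D\<close> less.prems(2) by auto
    then show ?thesis using class_eq by blast
  qed
qed

lemma maxchain_le:
  fixes D \<Gamma> :: "'l::order set"
  assumes "pred_on.maxchain D (<) \<Gamma>"
  shows "\<Gamma> \<subseteq> D" "\<forall>x\<in>\<Gamma>. \<forall>y\<in>\<Gamma>. x \<le> y \<or> y \<le> x"
    "z \<in> D \<Longrightarrow> (\<And>x. x \<in> \<Gamma> \<Longrightarrow> x \<le> z \<or> z \<le> x) \<Longrightarrow> z \<in> \<Gamma>"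
proof -
  have chain: "pred_on.chain D (<) \<Gamma>" and max: "\<And>C. pred_on.chain D (<) C \<Longrightarrow> \<not> \<Gamma> \<subset> C"
    using assms unfolding pred_on.maxchain_def by blast+
  then show "\<Gamma> \<subseteq> D" and total: "\<forall>x\<in>\<Gamma>. \<forall>y\<in>\<Gamma>. x \<le> y \<or> y \<le> x"
    unfolding pred_on.chain_def by force+
  show "z \<in> \<Gamma>" if "z \<in> D" and comparable: "\<And>x. x \<in> \<Gamma> \<Longrightarrow> x \<le> z \<or> z \<le> x"
  proof -
    have "pred_on.chain D (<) (insert z \<Gamma>)"
      using \<open>\<Gamma> \<subseteq> D\<close> \<open>z \<in> D\<close> total comparable unfolding pred_on.chain_def by (auto simp: less_le)
    with max show ?thesis by blast
  qed
qed

text \<open>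
  Hence restricting to representatives in \<open>Z_set D \<Gamma>\<close> loses no class, and the classes that index the
  basis do not depend on the chain \<open>\<Gamma>\<close>.
\<close>

lemma G_set_eq:
  fixes D \<Gamma> :: "'l::{finite,distrib_lattice} set"
  assumes D: "two_sided_closed D" and \<Gamma>: "pred_on.maxchain D (<) \<Gamma>"
  shows "G_set D \<Gamma> = {C \<in> (- D) // side_equiv D. C \<inter> E_set D = {}}"
proof (intro equalityI subsetI)
  fix C assume C: "C \<in> {C \<in> (- D) // side_equiv D. C \<inter> E_set D = {}}"
  then obtain \<theta> where \<theta>: "C = side_equiv D `` {\<theta>}" "\<theta> \<notin> D"
    by (auto elim: quotientE)
  with C class_meets_comparable[OF D maxchain_le(1,2)[OF \<Gamma>], of \<theta>]
  obtain \<delta> where \<delta>: "\<delta> \<in> Lambda_set \<Gamma>" "(\<theta>, \<delta>) \<in> side_equiv D" by auto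
  then have "\<delta> \<notin> D" by (simp add: side_equiv_def)
  have "C = side_equiv D `` {\<delta>}"
    using equiv_class_eq[OF equiv_side_equiv \<delta>(2)] \<theta>(1) by simp
  moreover from this have "\<delta> \<in> Z_set D \<Gamma>"
    using \<delta> \<open>\<delta> \<notin> D\<close> maxchain_le(1)[OF \<Gamma>] C \<theta>(1) by (auto simp: Z_set_def)
  ultimately show "C \<in> G_set D \<Gamma>"
    using C unfolding G_set_def by blast
next
  fix C assume "C \<in> G_set D \<Gamma>"
  then obtain \<theta> where \<theta>: "C = side_equiv D `` {\<theta>}" "\<theta> \<in> Z_set D \<Gamma>" "C \<inter> E_set D = {}"
    unfolding G_set_def by blast
  have "\<theta> \<notin> D"
    using \<theta>(2) maxchain_le(3)[OF \<Gamma>, of \<theta>] mem_Lambda_set_iff[OF maxchain_le(2)[OF \<Gamma>], of \<theta>]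
    unfolding Z_set_def by blast
  with \<theta> show "C \<in> {C \<in> (- D) // side_equiv D. C \<inter> E_set D = {}}"
    by (auto intro: quotientI)
qed

section \<open>Chains and valuations\<close>

lemma comparable_with_maxchain:
  fixes D \<Gamma> :: "'l::order set"
  assumes "pred_on.maxchain D (<) \<Gamma>" and "z \<in> D" and "\<forall>x\<in>\<Gamma>. x \<le> z \<or> z \<le> x"
  shows "z \<in> \<Gamma>"
  by (rule maxchain_le(3)[OF assms(1,2)]) (use assms(3) in blast)

text \<open>
  Inducting upwards along the chain, the predecessor \<open>\<delta>\<close> of \<open>\<gamma>\<close> and \<open>inf \<alpha> \<gamma>\<close> have the meet
  \<open>inf \<alpha> \<delta>\<close>, and their join lies between \<open>\<delta>\<close> and \<open>\<gamma>\<close>, hence in the maximal chain.  So the step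
  rule applies to them and yields \<open>Q (inf \<alpha> \<gamma>)\<close>.  For the top \<open>\<gamma>\<close> of the chain, \<open>inf \<alpha> \<gamma> = \<alpha>\<close>.
\<close>

lemma maxchain_generates:
  fixes D \<Gamma> :: "'l::{finite,distrib_lattice} set"
  assumes D: "two_sided_closed D" and \<Gamma>: "pred_on.maxchain D (<) \<Gamma>"
    and base: "\<And>\<gamma>. \<gamma> \<in> \<Gamma> \<Longrightarrow> Q \<gamma>"
    and step: "\<And>a b. a \<in> D \<Longrightarrow> b \<in> D \<Longrightarrow> Q a \<Longrightarrow> Q (sup a b) \<Longrightarrow> Q (inf a b) \<Longrightarrow> Q b"
    and "\<alpha> \<in> D"
  shows "Q \<alpha>"
proof -
  note sub = maxchain_le(1)[OF \<Gamma>] and total = maxchain_le(2)[OF \<Gamma>]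
  have meet: "Q (inf \<alpha> \<gamma>)" if "\<gamma> \<in> \<Gamma>" for \<gamma>
    using that
  proof (induction "card {\<delta>\<in>\<Gamma>. \<delta> < \<gamma>}" arbitrary: \<gamma> rule: less_induct)
    case less
    have "\<gamma> \<in> D" using less.prems sub by blast
    then have inf_D: "inf \<alpha> \<gamma> \<in> D" using two_sided_closedD(2)[OF D] \<open>\<alpha> \<in> D\<close> by blast
    show ?case
    proof (cases "{\<delta>\<in>\<Gamma>. \<delta> < \<gamma>} = {}")
      case True
      have "\<forall>x\<in>\<Gamma>. x \<le> inf \<alpha> \<gamma> \<or> inf \<alpha> \<gamma> \<le> x"
        using True total less.prems by (auto simp: less_le intro: le_infI2)
      then show ?thesis using base comparable_with_maxchain[OF \<Gamma> inf_D] by blast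
    next
      case False
      then obtain \<delta> where \<delta>: "\<delta> \<in> \<Gamma>" "\<delta> < \<gamma>" and max: "\<And>\<epsilon>. \<epsilon> \<in> \<Gamma> \<Longrightarrow> \<epsilon> < \<gamma> \<Longrightarrow> \<delta> \<le> \<epsilon> \<Longrightarrow> \<epsilon> = \<delta>"
        using finite_has_maximal[of "{\<delta>\<in>\<Gamma>. \<delta> < \<gamma>}"] by auto
      have below: "\<epsilon> \<le> \<delta> \<or> \<gamma> \<le> \<epsilon>" if "\<epsilon> \<in> \<Gamma>" for \<epsilon>
        using max[OF that] total that \<delta>(1) less.prems by (metis less_le)
      have "\<delta> \<in> D" using \<delta>(1) sub by blast
      have "{\<epsilon>\<in>\<Gamma>. \<epsilon> < \<delta>} \<subset> {\<epsilon>\<in>\<Gamma>. \<epsilon> < \<gamma>}" using \<delta> by auto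
      then have "Q (inf \<alpha> \<delta>)"
        using less.hyps[of \<delta>] \<delta>(1) by (simp add: psubset_card_mono)
      moreover have "inf \<delta> (inf \<alpha> \<gamma>) = inf \<alpha> \<delta>"
        using \<delta>(2) by (metis inf.absorb1 inf.commute inf.left_commute less_imp_le)
      moreover have "sup \<delta> (inf \<alpha> \<gamma>) \<in> \<Gamma>"
      proof (rule comparable_with_maxchain[OF \<Gamma>])
        show "sup \<delta> (inf \<alpha> \<gamma>) \<in> D"
          using two_sided_closedD(1)[OF D \<open>\<delta> \<in> D\<close> inf_D] .
        have "sup \<delta> (inf \<alpha> \<gamma>) \<le> \<gamma>" using \<delta>(2) by simp
        then show "\<forall>x\<in>\<Gamma>. x \<le> sup \<delta> (inf \<alpha> \<gamma>) \<or> sup \<delta> (inf \<alpha> \<gamma>) \<le> x"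
          using below by (meson le_supI1 order_trans)
      qed
      ultimately show ?thesis
        using step[OF \<open>\<delta> \<in> D\<close> inf_D base[OF \<delta>(1)]] base by simp
    qed
  qed
  have "\<Gamma> \<noteq> {}" using comparable_with_maxchain[OF \<Gamma> \<open>\<alpha> \<in> D\<close>] by blast
  then obtain \<gamma> where \<gamma>: "\<gamma> \<in> \<Gamma>" and max: "\<And>\<epsilon>. \<epsilon> \<in> \<Gamma> \<Longrightarrow> \<gamma> \<le> \<epsilon> \<Longrightarrow> \<epsilon> = \<gamma>"
    using finite_has_maximal[of \<Gamma>] by auto
  have "sup \<alpha> \<gamma> \<in> \<Gamma>"
  proof (rule comparable_with_maxchain[OF \<Gamma>])
    show "sup \<alpha> \<gamma> \<in> D"
      using two_sided_closedD(1)[OF D \<open>\<alpha> \<in> D\<close>] \<gamma> sub by blast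
    show "\<forall>x\<in>\<Gamma>. x \<le> sup \<alpha> \<gamma> \<or> sup \<alpha> \<gamma> \<le> x"
      using max total \<gamma> by (metis le_supI2)
  qed
  then have "sup \<alpha> \<gamma> = \<gamma>" using max by simp
  then have "inf \<alpha> \<gamma> = \<alpha>" by (metis inf_sup_absorb)
  then show ?thesis using meet[OF \<gamma>] by simp
qed

text \<open>
  A minimal element among those below \<open>b\<close> but not below \<open>a\<close> is join-prime: in a distributive lattice,
  if it were below \<open>sup x y\<close> only, it would be the join of its meets with \<open>x\<close> and \<open>y\<close>, which are both
  below \<open>a\<close> by minimality.
\<close>

lemma join_prime_separation:
  fixes a b :: "'l::{finite,distrib_lattice}"
  assumes "\<not> b \<le> a"
  obtains j where "j \<le> b" "\<not> j \<le> a" "\<And>x y. j \<le> sup x y \<longleftrightarrow> j \<le> x \<or> j \<le> y"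
proof -
  let ?S = "{j. j \<le> b \<and> \<not> j \<le> a}"
  obtain j where j: "j \<le> b" "\<not> j \<le> a" and min: "\<And>i. i \<le> b \<Longrightarrow> \<not> i \<le> a \<Longrightarrow> i \<le> j \<Longrightarrow> i = j"
    using finite_has_minimal[of ?S] assms by auto
  have "j \<le> x \<or> j \<le> y" if "j \<le> sup x y" for x y
  proof (rule ccontr)
    assume "\<not> (j \<le> x \<or> j \<le> y)"
    then have "inf j x \<le> a" "inf j y \<le> a"
      using min[of "inf j x"] min[of "inf j y"] j(1) by (metis inf.cobounded1 inf.cobounded2 order_trans)+
    then have "inf j (sup x y) \<le> a" by (simp add: inf_sup_distrib1)
    with that j(2) show False by (simp add: inf_absorb1)
  qed
  with j show thesis by (intro that) (auto intro: le_supI1 le_supI2)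
qed

text \<open>
  This identity is the tangent equation for a diamond with all vertices in \<open>D\<close>.
\<close>

definition valuation :: "('l::lattice \<Rightarrow> 'k::ab_group_add) \<Rightarrow> bool" where
  "valuation w \<longleftrightarrow> (\<forall>a b. w a + w b = w (sup a b) + w (inf a b))"

text \<open>
  The indicator function of the principal filter of a join-prime element is a valuation; one that
  separates \<open>\<gamma>\<close> from its predecessor in the chain has the required values on the chain.
\<close>

lemma valuation_step_on_chain:
  fixes \<Gamma> :: "'l::{finite,distrib_lattice} set"
  assumes total: "\<forall>x\<in>\<Gamma>. \<forall>y\<in>\<Gamma>. x \<le> y \<or> y \<le> x" and "\<gamma> \<in> \<Gamma>"
  shows "\<exists>w :: 'l \<Rightarrow> 'k::ring_1. valuation w \<and> (\<forall>\<delta>\<in>\<Gamma>. w \<delta> = of_bool (\<gamma> \<le> \<delta>))"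
proof (cases "{\<delta>\<in>\<Gamma>. \<delta> < \<gamma>} = {}")
  case True
  \<comment> \<open>At the least element of the chain the step is constant.\<close>
  then have "\<forall>\<delta>\<in>\<Gamma>. (1::'k) = of_bool (\<gamma> \<le> \<delta>)" using total assms(2) by (auto simp: less_le)
  then show ?thesis by (intro exI[of _ "\<lambda>_. 1"]) (simp add: valuation_def)
next
  case False
  then obtain \<delta> where \<delta>: "\<delta> \<in> \<Gamma>" "\<delta> < \<gamma>" and max: "\<And>\<epsilon>. \<epsilon> \<in> \<Gamma> \<Longrightarrow> \<epsilon> < \<gamma> \<Longrightarrow> \<delta> \<le> \<epsilon> \<Longrightarrow> \<epsilon> = \<delta>"
    using finite_has_maximal[of "{\<delta>\<in>\<Gamma>. \<delta> < \<gamma>}"] by auto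
  have below: "\<epsilon> \<le> \<delta> \<or> \<gamma> \<le> \<epsilon>" if "\<epsilon> \<in> \<Gamma>" for \<epsilon>
    using max[OF that] total that \<delta>(1) assms(2) by (metis less_le)
  obtain j where j: "j \<le> \<gamma>" "\<not> j \<le> \<delta>" "\<And>x y. j \<le> sup x y \<longleftrightarrow> j \<le> x \<or> j \<le> y"
    using join_prime_separation[of \<gamma> \<delta>] \<delta>(2) by (auto simp: less_le_not_le)
  have "valuation (\<lambda>x. of_bool (j \<le> x) :: 'k)"
    by (auto simp: valuation_def j(3))
  moreover have "j \<le> \<epsilon> \<longleftrightarrow> \<gamma> \<le> \<epsilon>" if "\<epsilon> \<in> \<Gamma>" for \<epsilon>
    using below[OF that] j(1,2) by (meson order_trans)
  ultimately show ?thesis by (intro exI[of _ "\<lambda>x. of_bool (j \<le> x)"]) simp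
qed

text \<open>
  The difference of the step valuations at \<open>\<gamma>\<close> and at its successor.
\<close>

lemma valuation_dual_to_chain:
  fixes \<Gamma> :: "'l::{finite,distrib_lattice} set"
  assumes total: "\<forall>x\<in>\<Gamma>. \<forall>y\<in>\<Gamma>. x \<le> y \<or> y \<le> x" and "\<gamma> \<in> \<Gamma>"
  shows "\<exists>w :: 'l \<Rightarrow> 'k::ring_1. valuation w \<and> (\<forall>\<delta>\<in>\<Gamma>. w \<delta> = of_bool (\<delta> = \<gamma>))"
proof -
  obtain u :: "'l \<Rightarrow> 'k" where u: "valuation u" "\<forall>\<delta>\<in>\<Gamma>. u \<delta> = of_bool (\<gamma> \<le> \<delta>)"
    using valuation_step_on_chain[OF assms] by blast
  have "\<exists>v :: 'l \<Rightarrow> 'k. valuation v \<and> (\<forall>\<delta>\<in>\<Gamma>. v \<delta> = of_bool (\<gamma> < \<delta>))"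
  proof (cases "{\<delta>\<in>\<Gamma>. \<gamma> < \<delta>} = {}")
    case True
    then show ?thesis by (intro exI[of _ "\<lambda>_. 0"]) (auto simp: valuation_def)
  next
    case False
    then obtain \<gamma>' where \<gamma>': "\<gamma>' \<in> \<Gamma>" "\<gamma> < \<gamma>'" and min: "\<And>\<epsilon>. \<epsilon> \<in> \<Gamma> \<Longrightarrow> \<gamma> < \<epsilon> \<Longrightarrow> \<epsilon> \<le> \<gamma>' \<Longrightarrow> \<epsilon> = \<gamma>'"
      using finite_has_minimal[of "{\<delta>\<in>\<Gamma>. \<gamma> < \<delta>}"] by auto
    have "\<gamma>' \<le> \<epsilon> \<longleftrightarrow> \<gamma> < \<epsilon>" if "\<epsilon> \<in> \<Gamma>" for \<epsilon>
      using min[OF that] total that \<gamma>' by (metis less_le_trans order_refl)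
    then show ?thesis using valuation_step_on_chain[OF total \<gamma>'(1), where 'k = 'k] by simp
  qed
  then obtain v :: "'l \<Rightarrow> 'k" where v: "valuation v" "\<forall>\<delta>\<in>\<Gamma>. v \<delta> = of_bool (\<gamma> < \<delta>)" by blast
  have "valuation (\<lambda>x. u x - v x)"
    using u(1) v(1) unfolding valuation_def by (metis add_diff_add)
  moreover have "u \<delta> - v \<delta> = of_bool (\<delta> = \<gamma>)" if "\<delta> \<in> \<Gamma>" for \<delta>
    using u(2) v(2) that by (auto simp: less_le)
  ultimately show ?thesis by (intro exI[of _ "\<lambda>x. u x - v x"]) simp
qed

section \<open>The linearised Hibi relations\<close>

lemma tangent_vector_valuation:
  fixes D :: "'l::lattice set" and w :: "'l \<Rightarrow> 'k::comm_ring_1"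
  assumes D: "two_sided_closed D" and "valuation w"
  shows "tangent_vector (\<lambda>\<alpha>. of_bool (\<alpha> \<in> D)) (\<lambda>\<alpha>. if \<alpha> \<in> D then w \<alpha> else 0)"
proof -
  have iff: "sup a b \<in> D \<and> inf a b \<in> D \<longleftrightarrow> a \<in> D \<and> b \<in> D" for a b
    using D unfolding two_sided_closed_def by blast
  have "w a + w b = w (sup a b) + w (inf a b)" for a b
    using assms(2) unfolding valuation_def by blast
  then show ?thesis
    using iff unfolding tangent_vector_def by (simp add: add.commute) (metis add.right_neutral)
qed

text \<open>
  In a diamond with no vertex or all vertices in \<open>D\<close> the tangent equation reads \<open>0 = 0\<close>, as \<open>C\<close> avoids
  \<open>D\<close>.  Otherwise, a side in \<open>D\<close> makes the ends of the opposite side equivalent, so that both or none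
  are in \<open>C\<close>, and a single vertex in \<open>D\<close> puts the opposite one into \<open>E_set D\<close>, which \<open>C\<close> avoids.
\<close>

lemma tangent_vector_class:
  fixes D C :: "'l::lattice set"
  assumes D: "two_sided_closed D" and C: "C \<in> (- D) // side_equiv D" "C \<inter> E_set D = {}"
  shows "tangent_vector (\<lambda>\<alpha>. of_bool (\<alpha> \<in> D)) (\<lambda>\<alpha>. of_bool (\<alpha> \<in> C) :: 'k::comm_ring_1)"
  unfolding tangent_vector_def
proof (intro allI)
  fix a b :: 'l
  let ?P = "\<lambda>\<alpha>. of_bool (\<alpha> \<in> D) :: 'k" and ?l = "\<lambda>\<alpha>. of_bool (\<alpha> \<in> C) :: 'k"
  have C_D: "x \<notin> C" if "x \<in> D" for x
    using in_quotient_imp_subset[OF equiv_side_equiv C(1)] that by blast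
  have C_E: "x \<notin> C" if "x \<in> E_set D" for x using C(2) that by blast
  have C_equiv: "x \<in> C \<longleftrightarrow> y \<in> C" if "(x, y) \<in> side_equiv D" for x y
    using in_quotient_imp_closed[OF equiv_side_equiv C(1)] that equivE[OF equiv_side_equiv, of D]
    by (metis symD)
  show "?P a * ?l b + ?P b * ?l a = ?P (sup a b) * ?l (inf a b) + ?P (inf a b) * ?l (sup a b)"
  proof (cases "diamond a b")
    case False
    then show ?thesis by (auto simp: diamond_def sup_absorb1 sup_absorb2 inf_absorb1 inf_absorb2 add.commute)
  next
    case True
    note side = C_equiv[OF side_stepI[OF True]] and corner = C_E[OF one_vertex_in_E[OF True]]
    have iff: "sup a b \<in> D \<and> inf a b \<in> D \<longleftrightarrow> a \<in> D \<and> b \<in> D"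
      using D unfolding two_sided_closed_def by blast
    note defs = opposite_sides_def diamond_vertices_def diamond_diagonals_def
    have side1: "a \<in> D \<Longrightarrow> sup a b \<in> D \<Longrightarrow> b \<notin> D \<Longrightarrow> inf a b \<notin> D \<Longrightarrow> b \<in> C \<longleftrightarrow> inf a b \<in> C"
      by (rule side[of _ _ "{a, sup a b}"]) (auto simp: defs)
    have side2: "a \<in> D \<Longrightarrow> inf a b \<in> D \<Longrightarrow> b \<notin> D \<Longrightarrow> sup a b \<notin> D \<Longrightarrow> b \<in> C \<longleftrightarrow> sup a b \<in> C"
      by (rule side[of _ _ "{inf a b, a}"]) (auto simp: defs)
    have side3: "b \<in> D \<Longrightarrow> sup a b \<in> D \<Longrightarrow> a \<notin> D \<Longrightarrow> inf a b \<notin> D \<Longrightarrow> a \<in> C \<longleftrightarrow> inf a b \<in> C"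
      by (rule side[of _ _ "{b, sup a b}"]) (auto simp: defs)
    have side4: "b \<in> D \<Longrightarrow> inf a b \<in> D \<Longrightarrow> a \<notin> D \<Longrightarrow> sup a b \<notin> D \<Longrightarrow> a \<in> C \<longleftrightarrow> sup a b \<in> C"
      by (rule side[of _ _ "{inf a b, b}"]) (auto simp: defs)
    have corner1: "a \<in> D \<Longrightarrow> sup a b \<notin> D \<Longrightarrow> inf a b \<notin> D \<Longrightarrow> b \<notin> D \<Longrightarrow> b \<notin> C"
      by (rule corner[of "a"]) (auto simp: defs)
    have corner2: "b \<in> D \<Longrightarrow> sup a b \<notin> D \<Longrightarrow> inf a b \<notin> D \<Longrightarrow> a \<notin> D \<Longrightarrow> a \<notin> C"
      by (rule corner[of "b"]) (auto simp: defs)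
    have corner3: "sup a b \<in> D \<Longrightarrow> a \<notin> D \<Longrightarrow> b \<notin> D \<Longrightarrow> inf a b \<notin> D \<Longrightarrow> inf a b \<notin> C"
      by (rule corner[of "sup a b"]) (auto simp: defs)
    have corner4: "inf a b \<in> D \<Longrightarrow> a \<notin> D \<Longrightarrow> b \<notin> D \<Longrightarrow> sup a b \<notin> D \<Longrightarrow> sup a b \<notin> C"
      by (rule corner[of "inf a b"]) (auto simp: defs)
    show ?thesis
      using iff
      by (cases "a \<in> D"; cases "b \<in> D"; cases "sup a b \<in> D"; cases "inf a b \<in> D")
        (simp_all add: C_D side1 side2 side3 side4 corner1 corner2 corner3 corner4)
  qed
qed

lemma diamond_distinct:
  assumes "diamond a b"
  shows "a \<noteq> b" "b \<noteq> a" "sup a b \<noteq> a" "sup a b \<noteq> b" "inf a b \<noteq> a" "inf a b \<noteq> b"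
    "a \<noteq> sup a b" "b \<noteq> sup a b" "a \<noteq> inf a b" "b \<noteq> inf a b" "sup a b \<noteq> inf a b" "inf a b \<noteq> sup a b"
proof -
  have "a \<le> sup a b" "b \<le> sup a b" "inf a b \<le> a" "inf a b \<le> b" by simp_all
  moreover have "\<not> a \<le> b" "\<not> b \<le> a" using assms by (simp_all add: diamond_def)
  ultimately show "a \<noteq> b" "b \<noteq> a" "sup a b \<noteq> a" "sup a b \<noteq> b" "inf a b \<noteq> a" "inf a b \<noteq> b"
    "a \<noteq> sup a b" "b \<noteq> sup a b" "a \<noteq> inf a b" "b \<noteq> inf a b" "sup a b \<noteq> inf a b" "inf a b \<noteq> sup a b"
    by force+
qed

text \<open>
  For coordinates \<open>y\<close> satisfying the linearised Hibi relations modulo a subgroup \<open>J\<close>, a diamond with a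
  single vertex in \<open>D\<close> kills the coordinate of the opposite vertex, and a diamond with a side in \<open>D\<close>
  identifies the coordinates of the ends of the opposite side.
\<close>

lemma E_set_relation:
  fixes D :: "'l::lattice set" and y :: "'l \<Rightarrow> 'v::ab_group_add"
  assumes rel: "\<And>a b. (if a \<in> D then y b else 0) + (if b \<in> D then y a else 0)
      - (if sup a b \<in> D then y (inf a b) else 0) - (if inf a b \<in> D then y (sup a b) else 0) \<in> J"
    and minus: "\<And>x. x \<in> J \<Longrightarrow> - x \<in> J" and "\<theta> \<in> E_set D"
  shows "y \<theta> \<in> J"
proof -
  obtain \<beta> a b where \<beta>: "\<beta> \<in> D" "\<theta> \<notin> D" and ab: "diamond a b" "{\<theta>, \<beta>} \<in> diamond_diagonals a b"
      "diamond_vertices a b \<inter> D = {\<beta>}"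
    using assms(3) unfolding E_set_def by blast
  have mem: "x \<in> D \<longleftrightarrow> x = \<beta>" if "x \<in> {a, b, sup a b, inf a b}" for x
    using ab(3) that unfolding diamond_vertices_def by blast
  note neq = diamond_distinct[OF ab(1)]
  have "(\<theta> = a \<and> \<beta> = b) \<or> (\<theta> = b \<and> \<beta> = a) \<or> (\<theta> = sup a b \<and> \<beta> = inf a b) \<or> (\<theta> = inf a b \<and> \<beta> = sup a b)"
    using ab(2) by (auto simp: diamond_diagonals_def doubleton_eq_iff)
  then show ?thesis
  proof (elim disjE conjE)
    assume "\<theta> = a" "\<beta> = b"
    then have "a \<notin> D" "b \<in> D" "sup a b \<notin> D" "inf a b \<notin> D" using mem neq by simp_all
    then show ?thesis using rel[of a b] \<open>\<theta> = a\<close> by simp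
  next
    assume "\<theta> = b" "\<beta> = a"
    then have "a \<in> D" "b \<notin> D" "sup a b \<notin> D" "inf a b \<notin> D" using mem neq by simp_all
    then show ?thesis using rel[of a b] \<open>\<theta> = b\<close> by simp
  next
    assume "\<theta> = sup a b" "\<beta> = inf a b"
    then have "a \<notin> D" "b \<notin> D" "sup a b \<notin> D" "inf a b \<in> D" using mem neq by simp_all
    then show ?thesis using rel[of a b] \<open>\<theta> = sup a b\<close> minus[of "- y \<theta>"] by simp
  next
    assume "\<theta> = inf a b" "\<beta> = sup a b"
    then have "a \<notin> D" "b \<notin> D" "sup a b \<in> D" "inf a b \<notin> D" using mem neq by simp_all
    then show ?thesis using rel[of a b] \<open>\<theta> = inf a b\<close> minus[of "- y \<theta>"] by simp
  qed
qed

lemma side_equiv_relation: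
  fixes D :: "'l::lattice set" and y :: "'l \<Rightarrow> 'v::ab_group_add"
  assumes rel: "\<And>a b. (if a \<in> D then y b else 0) + (if b \<in> D then y a else 0)
      - (if sup a b \<in> D then y (inf a b) else 0) - (if inf a b \<in> D then y (sup a b) else 0) \<in> J"
    and zero: "0 \<in> J" and minus: "\<And>x. x \<in> J \<Longrightarrow> - x \<in> J" and add: "\<And>x x'. x \<in> J \<Longrightarrow> x' \<in> J \<Longrightarrow> x + x' \<in> J"
    and "(\<theta>, \<delta>) \<in> side_equiv D"
  shows "y \<theta> - y \<delta> \<in> J"
proof -
  have one: "y x - y z \<in> J" if xz: "(x, z) \<in> side_step D" for x z
  proof -
    obtain a b S where ab: "diamond a b" "({x, z}, S) \<in> opposite_sides a b" "S \<subseteq> D" "x \<notin> D" "z \<notin> D"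
      using xz by (auto simp: side_step_def)
    have minus': "y x - y z \<in> J" if "y z - y x \<in> J"
      using minus[OF that] by simp
    have not_D: "w \<notin> D" if "{x, z} = {v, w} \<or> {x, z} = {w, v}" for v w
      using that ab(4,5) by (auto simp: doubleton_eq_iff)
    from ab(2) consider "{x, z} = {a, sup a b}" "S = {inf a b, b}" | "{x, z} = {inf a b, b}" "S = {a, sup a b}"
      | "{x, z} = {b, sup a b}" "S = {inf a b, a}" | "{x, z} = {inf a b, a}" "S = {b, sup a b}"
      unfolding opposite_sides_def by auto
    then show ?thesis
    proof cases
      case 1
      then have "a \<notin> D" "sup a b \<notin> D" using not_D by blast+
      then have "y a - y (sup a b) \<in> J" using rel[of a b] ab(3) 1(2) by simp
      with 1(1) minus' show ?thesis by (auto simp: doubleton_eq_iff)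
    next
      case 2
      then have "b \<notin> D" "inf a b \<notin> D" using not_D by blast+
      then have "y b - y (inf a b) \<in> J" using rel[of a b] ab(3) 2(2) by simp
      with 2(1) minus' show ?thesis by (auto simp: doubleton_eq_iff)
    next
      case 3
      then have "b \<notin> D" "sup a b \<notin> D" using not_D by blast+
      then have "y b - y (sup a b) \<in> J" using rel[of a b] ab(3) 3(2) by simp
      with 3(1) minus' show ?thesis by (auto simp: doubleton_eq_iff)
    next
      case 4
      then have "a \<notin> D" "inf a b \<notin> D" using not_D by blast+
      then have "y a - y (inf a b) \<in> J" using rel[of a b] ab(3) 4(2) by simp
      with 4(1) minus' show ?thesis by (auto simp: doubleton_eq_iff)
    qed
  qed
  have "(\<theta>, \<delta>) \<in> (side_step D)\<^sup>*" using assms(5) by (simp add: side_equiv_def)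
  then show ?thesis
  proof (induction rule: rtrancl_induct)
    case base
    show ?case using zero by simp
  next
    case (step x z)
    show ?case using add[OF step.IH one[OF step.hyps(2)]] by simp
  qed
qed

section \<open>Generation and independence\<close>

text \<open>
  The local coordinate \<open>X\<^sub>\<alpha> - P\<^sub>\<alpha>\<close> at the point \<open>P\<close> with support \<open>D\<close>.  Up to the sign it represents
  \<open>F_bar P \<alpha>\<close>.
\<close>

definition local_coord :: "'l set \<Rightarrow> 'l \<Rightarrow> ('l, 'k::comm_ring_1) mpol" where
  "local_coord D \<alpha> = mpol_var \<alpha> - of_bool (\<alpha> \<in> D)"

context
  fixes P :: "'l::{finite,distrib_lattice} \<Rightarrow> 'k::field" and D :: "'l set"
  assumes P: "P = (\<lambda>\<alpha>. of_bool (\<alpha> \<in> D))" and D: "two_sided_closed D"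
begin

lemma point_support_eq: "point_support P = D"
  by (simp add: point_support_def P)

lemma point_on_variety: "P a * P b = P (sup a b) * P (inf a b)"
  using D unfolding two_sided_closed_def P by (auto simp flip: of_bool_conj)

lemma local_coord_eq: "local_coord D \<alpha> = mpol_var \<alpha> - mpol_const (P \<alpha>)"
  by (simp add: local_coord_def P mpol_const_simps of_bool_def)

lemma value_local_coord: "mpol_eval (\<lambda>c. c) P (local_coord D \<alpha>) = 0"
  by (simp add: local_coord_eq value_diff value_var value_const)

lemma derivation_local_coord: "derivation P l (local_coord D \<alpha>) = l \<alpha>"
  by (simp add: local_coord_eq derivation_diff)

lemma F_bar_eq: "F_bar P \<alpha> = cot_class P (if \<alpha> \<in> D then - local_coord D \<alpha> else local_coord D \<alpha>)"
  by (simp add: F_bar_def F_elem_def cot_class_def point_support_eq hibi_class_simps local_coord_def)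

text \<open>
  Substituting \<open>X\<^sub>x = y\<^sub>x + P\<^sub>x\<close> into a Hibi binomial and discarding products of two local coordinates
  \<open>y\<^sub>x\<close> leaves the linear part \<open>P\<^sub>a y\<^sub>b + P\<^sub>b y\<^sub>a - P\<^sub>s y\<^sub>i - P\<^sub>i y\<^sub>s\<close>; the constant term vanishes as \<open>P\<close>
  is a point of the variety.
\<close>

lemma local_coord_relation:
  "(if a \<in> D then local_coord D b else 0) + (if b \<in> D then local_coord D a else 0)
    - (if sup a b \<in> D then local_coord D (inf a b) else 0)
    - (if inf a b \<in> D then local_coord D (sup a b) else 0) \<in> second_order P" (is "?r \<in> _")
proof -
  let ?y = "local_coord D" and ?g = "mpol_var a * mpol_var b - mpol_var (sup a b) * mpol_var (inf a b)"
  have iff: "sup a b \<in> D \<and> inf a b \<in> D \<longleftrightarrow> a \<in> D \<and> b \<in> D"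
    using D unfolding two_sided_closed_def by blast
  then have eq: "?r = ?g + (- (?y a * ?y b) + ?y (sup a b) * ?y (inf a b))"
    by (cases "a \<in> D"; cases "b \<in> D"; cases "sup a b \<in> D"; cases "inf a b \<in> D")
      (simp_all add: local_coord_def algebra_simps)
  have g: "?g \<in> second_order P"
    using hibi_ideal_subset_second_order hibi_relation_in_ideal by blast
  have y: "?y x * ?y z \<in> second_order P" for x z
    by (rule second_order_product) (simp_all add: value_local_coord)
  show ?thesis unfolding eq by (intro second_order_ideal(2,4) g y)
qed

lemma E_set_second_order: "\<theta> \<in> E_set D \<Longrightarrow> local_coord D \<theta> \<in> second_order P"
  by (rule E_set_relation[OF local_coord_relation]) (auto intro: second_order_ideal)

lemma side_equiv_second_order:
  "(\<theta>, \<delta>) \<in> side_equiv D \<Longrightarrow> local_coord D \<theta> - local_coord D \<delta> \<in> second_order P"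
  by (rule side_equiv_relation[OF local_coord_relation]) (auto intro: second_order_ideal)

lemma F_bar_class_eq:
  assumes "C \<in> (- D) // side_equiv D" and "\<theta> \<in> C"
  shows "F_bar_class P C = cot_class P (local_coord D \<theta>)"
proof -
  have "F_bar P \<delta> = cot_class P (local_coord D \<theta>)" if "\<delta> \<in> C" for \<delta>
  proof -
    have "(\<delta>, \<theta>) \<in> side_equiv D"
      using quotient_eq_iff[OF equiv_side_equiv assms(1,1) that assms(2)] by simp
    moreover from this have "\<delta> \<notin> D" by (simp add: side_equiv_def)
    ultimately show ?thesis
      by (simp add: F_bar_eq cot_class_eq_iff side_equiv_second_order)
  qed
  then have "F_bar P ` C = {cot_class P (local_coord D \<theta>)}" using assms(2) by auto
  then show ?thesis by (simp add: F_bar_class_def)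
qed

text \<open>
  The local coordinates generate.  Those indexed by \<open>D\<close> reduce to the chain by the modular relation;
  any other one equals its class, which is zero if the class meets \<open>E_set D\<close> and is in the
  generating set otherwise.
\<close>

lemma cotangent_generated:
  assumes \<Gamma>: "pred_on.maxchain D (<) \<Gamma>"
    and S: "S = F_bar_class P ` G_set D \<Gamma> \<union> F_bar P ` \<Gamma>" and "S \<subseteq> carrier (hibi_cotangent P)"
  shows "module.span ring_of_type_algebra (hibi_cotangent P) S = carrier (hibi_cotangent P)"
proof -
  interpret vectorspace "ring_of_type_algebra :: 'k ring" "hibi_cotangent P"
    by (rule vectorspace_hibi_cotangent)
  have sub: "submodule ring_of_type_algebra (span S) (hibi_cotangent P)"
    using span_is_submodule[OF assms(3)] .
  define U where "U = {p. cot_class P p \<in> span S}"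
  have zero: "0 \<in> U"
    using submodule.zero_closed[OF sub] by (simp add: U_def hibi_cotangent_simps)
  have add: "p + q \<in> U" if "p \<in> U" "q \<in> U" for p q
    using submodule.m_closed[OF sub] that by (simp add: U_def flip: hibi_cotangent_simps(3))
  have scale: "mpol_const c * p \<in> U" if "p \<in> U" for c p
    using submodule.smult_closed[OF sub] that
    by (simp add: U_def ring_of_type_algebra_def flip: hibi_cotangent_simps(4))
  have minus: "- p \<in> U" if "p \<in> U" for p
  proof -
    have "mpol_const (- 1) = (- 1 :: ('l, 'k) mpol)"
      by (simp add: mpol_const_def single_uminus)
    then show ?thesis using scale[OF that, of "- 1"] by simp
  qed
  have cong: "p \<in> U \<longleftrightarrow> q \<in> U" if "p - q \<in> second_order P" for p q
    using that by (simp add: U_def flip: cot_class_eq_iff)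
  have S_U: "p \<in> U" if "cot_class P p \<in> S" for p
    using that in_own_span[OF assms(3)] by (auto simp: U_def)
  have coord: "local_coord D \<alpha> \<in> U" for \<alpha>
  proof (cases "\<alpha> \<in> D")
    case True
    show ?thesis
    proof (rule maxchain_generates[OF D \<Gamma> _ _ True])
      fix \<gamma> assume "\<gamma> \<in> \<Gamma>"
      then have "\<gamma> \<in> D" using maxchain_le(1)[OF \<Gamma>] by blast
      then have "- local_coord D \<gamma> \<in> U"
        using \<open>\<gamma> \<in> \<Gamma>\<close> F_bar_eq[of \<gamma>] by (intro S_U) (auto simp: S)
      then show "local_coord D \<gamma> \<in> U" using minus by fastforce
    next
      fix a b
      assume "a \<in> D" "b \<in> D" and U: "local_coord D a \<in> U"
        "local_coord D (sup a b) \<in> U" "local_coord D (inf a b) \<in> U"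
      then have "local_coord D b
          - (local_coord D (sup a b) + local_coord D (inf a b) + - local_coord D a) \<in> second_order P"
        using local_coord_relation[of a b] two_sided_closedD(1,2)[OF D] by (simp add: algebra_simps)
      moreover have "local_coord D (sup a b) + local_coord D (inf a b) + - local_coord D a \<in> U"
        by (intro add minus U)
      ultimately show "local_coord D b \<in> U" by (simp only: cong)
    qed
  next
    case False
    define C where "C = side_equiv D `` {\<alpha>}"
    have C: "C \<in> (- D) // side_equiv D" "\<alpha> \<in> C"
      using False quotientI[of \<alpha> "- D" "side_equiv D"] by (simp_all add: C_def) (simp add: side_equiv_def)
    show ?thesis
    proof (cases "C \<inter> E_set D = {}")
      case True
      then have "C \<in> G_set D \<Gamma>" using C(1) G_set_eq[OF D \<Gamma>] by blast
      then show ?thesis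
        using F_bar_class_eq[OF C] by (intro S_U) (auto simp: S)
    next
      case False
      then obtain \<theta> where "(\<alpha>, \<theta>) \<in> side_equiv D" "\<theta> \<in> E_set D" by (auto simp: C_def)
      then have "(local_coord D \<alpha> - local_coord D \<theta>) + local_coord D \<theta> \<in> second_order P"
        by (intro second_order_ideal(2) side_equiv_second_order E_set_second_order)
      then show ?thesis using cong[of "local_coord D \<alpha>" 0] zero by simp
    qed
  qed
  have "p \<in> U" if "mpol_eval (\<lambda>c. c) P p = 0" for p
  proof (rule vanishing_induct[OF zero add scale _ _ that])
    fix p q :: "('l, 'k) mpol" assume "mpol_eval (\<lambda>c. c) P p = 0" "mpol_eval (\<lambda>c. c) P q = 0"
    then have "p * q \<in> second_order P" by (rule second_order_product)
    then show "p * q \<in> U" using cong[of "p * q" 0] zero by simp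
  next
    show "mpol_var \<alpha> - mpol_const (P \<alpha>) \<in> U" for \<alpha>
      using coord[of \<alpha>] by (simp add: local_coord_eq)
  qed
  then show ?thesis
    using span_closed[OF assms(3)] by (auto simp: hibi_cotangent_simps(1) U_def)
qed

text \<open>
  The dual family consists of the valuations dual to the chain, extended by zero outside \<open>D\<close>, and
  of the indicator functions of the classes.
\<close>

lemma cotangent_independent:
  assumes \<Gamma>: "pred_on.maxchain D (<) \<Gamma>"
  defines "I \<equiv> Inl ` \<Gamma> \<union> Inr ` G_set D \<Gamma>" and "F \<equiv> case_sum (F_bar P) (F_bar_class P)"
  shows "F ` I \<subseteq> carrier (hibi_cotangent P)" and "inj_on F I"
    and "\<not> module.lin_dep ring_of_type_algebra (hibi_cotangent P) (F ` I)"
proof -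
  interpret vectorspace "ring_of_type_algebra :: 'k ring" "hibi_cotangent P"
    by (rule vectorspace_hibi_cotangent)
  note chain = maxchain_le(1,2)[OF \<Gamma>]
  have G: "C \<in> (- D) // side_equiv D" "C \<inter> E_set D = {}" if "C \<in> G_set D \<Gamma>" for C
    using that G_set_eq[OF D \<Gamma>] by blast+
  obtain w :: "'l \<Rightarrow> 'l \<Rightarrow> 'k" where w: "valuation (w \<gamma>)" "\<forall>\<delta>\<in>\<Gamma>. w \<gamma> \<delta> = of_bool (\<delta> = \<gamma>)" if "\<gamma> \<in> \<Gamma>" for \<gamma>
    using valuation_dual_to_chain[OF chain(2), where 'k = 'k] by metis
  obtain r where r: "r C \<in> C" if "C \<in> G_set D \<Gamma>" for C
  proof -
    have "\<exists>x. x \<in> C" if "C \<in> G_set D \<Gamma>" for C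
      using in_quotient_imp_non_empty[OF equiv_side_equiv G(1)[OF that]] by blast
    then show thesis using that by metis
  qed
  have r_D: "r C \<notin> D" if "C \<in> G_set D \<Gamma>" for C
    using in_quotient_imp_subset[OF equiv_side_equiv G(1)[OF that]] r[OF that] by blast
  have r_mem: "r C' \<in> C \<longleftrightarrow> C = C'" if "C \<in> G_set D \<Gamma>" "C' \<in> G_set D \<Gamma>" for C C'
    using quotient_disj[OF equiv_side_equiv G(1)[OF that(1)] G(1)[OF that(2)]] r that by blast
  define l where "l = case_sum (\<lambda>\<gamma> \<alpha>. if \<alpha> \<in> D then w \<gamma> \<alpha> else 0) (\<lambda>C \<alpha>. of_bool (\<alpha> \<in> C) :: 'k)"
  \<comment> \<open>Representatives of the candidate basis vectors; the sign comes from \<open>1 - x\<^sub>\<gamma>\<close>.\<close>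
  define g where "g = case_sum (\<lambda>\<gamma>. - local_coord D \<gamma>) (\<lambda>C. local_coord D (r C) :: ('l, 'k) mpol)"
  have tangent: "tangent_vector P (l i)" if "i \<in> I" for i
    using that unfolding I_def P
  proof (elim UnE imageE)
    fix \<gamma> assume "i = Inl \<gamma>" "\<gamma> \<in> \<Gamma>"
    then show "tangent_vector (\<lambda>\<alpha>. of_bool (\<alpha> \<in> D)) (l i)"
      using tangent_vector_valuation[OF D w(1)] by (simp add: l_def)
  next
    fix C assume "i = Inr C" "C \<in> G_set D \<Gamma>"
    then show "tangent_vector (\<lambda>\<alpha>. of_bool (\<alpha> \<in> D)) (l i)"
      using tangent_vector_class[OF D G] by (simp add: l_def)
  qed
  have minus: "mpol_eval (\<lambda>c. c) P (- p) = - mpol_eval (\<lambda>c. c) P p"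
      "derivation P l (- p) = - derivation P l p" for p l
    using value_diff[of P 0 p] derivation_diff[of P l 0 p] by (simp_all add: mpol_eval_def derivation_def)
  have F_g: "F i = cot_class P (g i)" "mpol_eval (\<lambda>c. c) P (g i) = 0" if "i \<in> I" for i
    using that chain(1) F_bar_class_eq[OF G(1) r]
    by (auto simp: I_def F_def g_def F_bar_eq minus value_local_coord)
  let ?f = "\<lambda>i. cot_functional P (l i)"
  have f: "?f i (cot_class P p) = derivation P (l i) p" if "i \<in> I" for i p
    by (rule cot_functional_cot_class[OF point_on_variety tangent[OF that]])
  have diag: "derivation P (l i) (g i) \<noteq> 0" if "i \<in> I" for i
    using that w(2) chain(1) r by (auto simp: I_def l_def g_def minus derivation_local_coord)
  have off_diag: "derivation P (l i) (g j) = 0" if ij: "i \<in> I" "j \<in> I" "i \<noteq> j" for i j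
  proof -
    consider \<gamma> \<delta> where "i = Inl \<gamma>" "j = Inl \<delta>" "\<gamma> \<in> \<Gamma>" "\<delta> \<in> \<Gamma>"
      | \<gamma> C where "i = Inl \<gamma>" "j = Inr C" "\<gamma> \<in> \<Gamma>" "C \<in> G_set D \<Gamma>"
      | C \<gamma> where "i = Inr C" "j = Inl \<gamma>" "\<gamma> \<in> \<Gamma>" "C \<in> G_set D \<Gamma>"
      | C C' where "i = Inr C" "j = Inr C'" "C \<in> G_set D \<Gamma>" "C' \<in> G_set D \<Gamma>"
      using ij(1,2) unfolding I_def by blast
    then show ?thesis
    proof cases
      case 1
      then show ?thesis using ij(3) w(2) by (simp add: l_def g_def minus derivation_local_coord)
    next
      case 2
      then show ?thesis using r_D by (simp add: l_def g_def derivation_local_coord)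
    next
      case 3
      then have "\<gamma> \<notin> C"
        using in_quotient_imp_subset[OF equiv_side_equiv G(1)] chain(1) by blast
      then show ?thesis using 3 by (simp add: l_def g_def minus derivation_local_coord)
    next
      case 4
      then show ?thesis using ij(3) r_mem by (simp add: l_def g_def derivation_local_coord)
    qed
  qed
  have carrier: "F i \<in> carrier (hibi_cotangent P)" if "i \<in> I" for i
    using F_g[OF that] by (simp add: hibi_cotangent_simps(1))
  then show "F ` I \<subseteq> carrier (hibi_cotangent P)" by blast
  have K_simps: "carrier (ring_of_type_algebra :: 'k ring) = UNIV"
      "\<And>x y. x \<otimes>\<^bsub>ring_of_type_algebra\<^esub> y = (x * y :: 'k)"
      "\<And>x y. x \<oplus>\<^bsub>ring_of_type_algebra\<^esub> y = (x + y :: 'k)" "\<zero>\<^bsub>ring_of_type_algebra\<^esub> = (0 :: 'k)"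
    by (simp_all add: ring_of_type_algebra_def)
  have additive: "?f i (x \<oplus>\<^bsub>hibi_cotangent P\<^esub> y) = ?f i x \<oplus>\<^bsub>ring_of_type_algebra\<^esub> ?f i y"
    if "i \<in> I" "x \<in> carrier (hibi_cotangent P)" "y \<in> carrier (hibi_cotangent P)" for i x y
    using that by (auto simp: hibi_cotangent_simps K_simps f derivation_add)
  have homogeneous: "?f i (c \<odot>\<^bsub>hibi_cotangent P\<^esub> x) = c \<otimes>\<^bsub>ring_of_type_algebra\<^esub> ?f i x"
    if "i \<in> I" "x \<in> carrier (hibi_cotangent P)" for i c x
    using that by (auto simp: hibi_cotangent_simps K_simps f derivation_mult value_const)
  have "inj_on F I \<and> lin_indpt (F ` I)"
  proof (rule dual_family_independent[of I F ?f])
    show "?f i (F i) \<noteq> \<zero>\<^bsub>ring_of_type_algebra\<^esub>" if "i \<in> I" for i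
      using diag[OF that] by (simp add: F_g(1)[OF that] f[OF that] K_simps)
    show "?f i (F j) = \<zero>\<^bsub>ring_of_type_algebra\<^esub>" if "i \<in> I" "j \<in> I" "i \<noteq> j" for i j
      using off_diag[OF that] by (simp add: F_g(1)[OF that(2)] f[OF that(1)] K_simps)
    show "?f i (c \<odot>\<^bsub>hibi_cotangent P\<^esub> x) = c \<otimes>\<^bsub>ring_of_type_algebra\<^esub> ?f i x"
      if "i \<in> I" "x \<in> carrier (hibi_cotangent P)" for i c x
      by (rule homogeneous[OF that])
  qed (simp_all add: carrier additive K_simps)
  then show "inj_on F I" "lin_indpt (F ` I)" by blast+
qed

end

theorem theorem1:
  fixes \<sigma> \<tau> :: "(real ^ 'l::{finite,distrib_lattice}) set"
    and \<Gamma> D :: "'l set"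
    and P :: "'l \<Rightarrow> 'k::alg_closed_field"
    and K :: "'k ring"
    and V :: "('k, ('l, 'k) mpol set set) module"
  assumes "is_hibi_cone TYPE('k) \<sigma>"
    and "cone_face \<tau> \<sigma>"
    and "P = face_point \<tau>"
    and "D = point_support P"
    and "pred_on.maxchain D (<) \<Gamma>"
    and "K = ring_of_type_algebra"
    and "V = hibi_cotangent P"
  shows "vectorspace K V
    \<and> inj_on (F_bar_class P) (G_set D \<Gamma>)
    \<and> inj_on (F_bar P) \<Gamma>
    \<and> F_bar_class P ` G_set D \<Gamma> \<inter> F_bar P ` \<Gamma> = {}
    \<and> vectorspace.basis K V (F_bar_class P ` G_set D \<Gamma> \<union> F_bar P ` \<Gamma>)"
proof -
  have D: "two_sided_closed D"
    using face_support_two_sided_closed[OF assms(1,2)] by (simp add: assms(3,4))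
  have P: "P = (\<lambda>\<alpha>. of_bool (\<alpha> \<in> D))"
    by (auto simp: fun_eq_iff assms(3,4) point_support_def face_point_def)
  define I where "I = Inl ` \<Gamma> \<union> Inr ` G_set D \<Gamma>"
  define F where "F = case_sum (F_bar P) (F_bar_class P)"
  note independent = cotangent_independent[OF P D assms(5), folded I_def F_def]
  have image: "F ` I = F_bar_class P ` G_set D \<Gamma> \<union> F_bar P ` \<Gamma>"
    by (auto simp: I_def F_def image_Un image_image)
  have "inj_on (F \<circ> Inr) (G_set D \<Gamma>)" "inj_on (F \<circ> Inl) \<Gamma>"
    by (auto intro!: comp_inj_on inj_on_subset[OF independent(2)] simp: I_def)
  then have "inj_on (F_bar_class P) (G_set D \<Gamma>)" "inj_on (F_bar P) \<Gamma>"
    by (simp_all add: F_def comp_def)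
  moreover have "F_bar_class P C \<noteq> F_bar P \<gamma>" if "C \<in> G_set D \<Gamma>" "\<gamma> \<in> \<Gamma>" for C \<gamma>
    using inj_onD[OF independent(2), of "Inr C" "Inl \<gamma>"] that by (auto simp: F_def I_def)
  then have "F_bar_class P ` G_set D \<Gamma> \<inter> F_bar P ` \<Gamma> = {}" by blast
  moreover have V: "vectorspace K V"
    unfolding assms(6,7) by (rule vectorspace_hibi_cotangent)
  moreover have "vectorspace.basis K V (F ` I)"
    unfolding vectorspace.basis_def[OF V]
    using independent cotangent_generated[OF P D assms(5) image] by (simp add: assms(6,7))
  ultimately show ?thesis unfolding image by blast
qed

end
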